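(* Let $I=(c,d)\subset\mathbb{R}$ be an open interval, $p\in(1,\infty)$, $p'=\frac{p}{p-1}$, $\nu\in\{1,2\}$, and let $w$ be a Lebesgue measurable function on $I$ with $w>0$ a.e. on $I$ and $w^p\in L^1_{\mathrm{loc},(\nu,2)}$. For any $\Lambda\in(Ch_{p,w}(I))^*$ there exists $h\in L^{p'}_{1/w}(I)$ such that $$\Lambda f=\int_I h(x)\left[\int_{I_{\nu,x}}f\right]dx,\qquad f\in Ch_{p,w}(I),$$ and $\|\Lambda\|_{(Ch_{p,w}(I))^*}=\|h\|_{L^{p'}_{1/w}(I)}$.
   Context: The interval $I=(c,d)$ may be bounded or unbounded ($-\infty\le c<d\le\infty$). $\mathfrak{M}(I)$ is the space of all Lebesgue measurable functions $f:I\to[-\infty,\infty]$ (functions equal a.e. are identified). For $x\in I$ put $I_{1,x}:=I_{2,x}^*:=(c,x]$ and $I_{1,x}^*:=I_{2,x}:=[x,d)$. For $\nu\in\{1,2\}$: $$L^1_{\mathrm{loc},(\nu,1)}:=\Big\{f\in\mathfrak{M}(I):\int_{I_{\nu,x}}|f|<\infty\ \forall x\in I\Big\},\qquad L^1_{\mathrm{loc},(\nu,2)}:=\Big\{f\in\mathfrak{M}(I):\int_{I_{\nu,x}^*}|f|<\infty\ \forall x\in I\Big\}.$$ The weighted altered Cesàro–Copson space is $Ch_{p,w}(I):=\{f\in L^1_{\mathrm{loc},(\nu,1)}:\|f\|_{Ch_{p,w}(I)}<\infty\}$, where $$\|f\|_{Ch_{p,w}(I)}:=\left(\int_I\left|w(x)\int_{I_{\nu,x}}f\right|^p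 dx\right)^{1/p}.$$ $(Ch_{p,w}(I))^*$ is the space of continuous (real) linear functionals on $Ch_{p,w}(I)$ with the usual operator norm. $L^{p'}_{1/w}(I)$ is the space of $v\in\mathfrak{M}(I)$ with $\|v\|_{L^{p'}_{1/w}(I)}:=\|v\,\tfrac1w\|_{L^{p'}(I)}<\infty$. *)

theory Defs
  imports "HOL-Analysis.Analysis"
begin

text \<open>
  Throughout, \<open>I = einterval c d\<close>, and elements of \<open>\<MM>(I)\<close> are represented by extended-real valued
  functions on the reals, whose values off \<open>I\<close> are irrelevant. The spaces below are sets of such
  representatives; the identification of functions that agree a.e. on \<open>I\<close> is made explicit where it
  matters, namely in the definition of a functional (\<open>Ch_dual\<close>).
\<close>

definition meas_fun :: "ereal \<Rightarrow> ereal \<Rightarrow> (real \<Rightarrow> ereal) set"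
  where "meas_fun c d = borel_measurable (lebesgue_on (einterval c d))"

definition I_sub :: "ereal \<Rightarrow> ereal \<Rightarrow> nat \<Rightarrow> real \<Rightarrow> real set"
  where "I_sub c d \<nu> x = (if \<nu> = 1 then einterval c d \<inter> {..x} else einterval c d \<inter> {x..})"

definition I_sub_star :: "ereal \<Rightarrow> ereal \<Rightarrow> nat \<Rightarrow> real \<Rightarrow> real set"
  where "I_sub_star c d \<nu> x = (if \<nu> = 1 then einterval c d \<inter> {x..} else einterval c d \<inter> {..x})"

text \<open>Integral, with values in \<open>[0, \<infinity>]\<close>, of a nonnegative function.\<close>

definition nn_int :: "real set \<Rightarrow> (real \<Rightarrow> ereal) \<Rightarrow> ereal"
  where "nn_int S f = enn2ereal (\<integral>\<^sup>+x. e2ennreal (f x) \<partial>lebesgue_on S)"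

definition eintegrable_on :: "(real \<Rightarrow> ereal) \<Rightarrow> real set \<Rightarrow> bool"
  where "eintegrable_on f S \<longleftrightarrow>
    f \<in> borel_measurable (lebesgue_on S) \<and> nn_int S (\<lambda>x. \<bar>f x\<bar>) < \<infinity>"

text \<open>
  Lebesgue integral of an extended-real valued function. It is only meaningful if
  \<open>eintegrable_on f S\<close>; then \<open>f\<close> is finite a.e. on \<open>S\<close>, so passing to real values by \<open>real_of_ereal\<close>
  (which sends \<open>\<plusminus>\<infinity>\<close> to \<open>0\<close>) changes \<open>f\<close> on a null set only.
\<close>

definition eint :: "real set \<Rightarrow> (real \<Rightarrow> ereal) \<Rightarrow> real"
  where "eint S f = (LINT x|lebesgue_on S. real_of_ereal (f x))"

text \<open>Power with exponent \<open>r > 0\<close>, used for bases that are nonnegative (at least a.e.).\<close>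

definition epow :: "ereal \<Rightarrow> real \<Rightarrow> ereal"
  where "epow a r = (if a = \<infinity> then \<infinity> else ereal (real_of_ereal a powr r))"

definition Lp_norm :: "real \<Rightarrow> real set \<Rightarrow> (real \<Rightarrow> ereal) \<Rightarrow> ereal"
  where "Lp_norm p S f = epow (nn_int S (\<lambda>x. epow \<bar>f x\<bar> p)) (1 / p)"

definition L1_loc :: "ereal \<Rightarrow> ereal \<Rightarrow> nat \<Rightarrow> nat \<Rightarrow> (real \<Rightarrow> ereal) set"
  where "L1_loc c d \<nu> j = {f \<in> meas_fun c d. \<forall>x \<in> einterval c d.
    nn_int (if j = 1 then I_sub c d \<nu> x else I_sub_star c d \<nu> x) (\<lambda>y. \<bar>f y\<bar>) < \<infinity>}"

definition Ch_norm :: "ereal \<Rightarrow> ereal \<Rightarrow> nat \<Rightarrow> real \<Rightarrow> (real \<Rightarrow> ereal) \<Rightarrow> (real \<Rightarrow> ereal) \<Rightarrow> ereal"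
  where "Ch_norm c d \<nu> p w f =
    Lp_norm p (einterval c d) (\<lambda>x. w x * ereal (eint (I_sub c d \<nu> x) f))"

definition Ch :: "ereal \<Rightarrow> ereal \<Rightarrow> nat \<Rightarrow> real \<Rightarrow> (real \<Rightarrow> ereal) \<Rightarrow> (real \<Rightarrow> ereal) set"
  where "Ch c d \<nu> p w = {f \<in> L1_loc c d \<nu> 1. Ch_norm c d \<nu> p w f < \<infinity>}"

text \<open>
  The continuous real linear functionals on \<open>Ch\<close>. The first clause says that \<open>\<Lambda>\<close> is well defined on
  a.e.-classes. Members of \<open>Ch\<close> are finite a.e. on \<open>I\<close>, so the pointwise operations on \<open>ereal\<close> (where
  e.g. \<open>\<infinity> - \<infinity> = \<infinity>\<close> by convention) represent the vector space operations on classes.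
\<close>

definition Ch_dual ::
  "ereal \<Rightarrow> ereal \<Rightarrow> nat \<Rightarrow> real \<Rightarrow> (real \<Rightarrow> ereal) \<Rightarrow> ((real \<Rightarrow> ereal) \<Rightarrow> real) set"
  where "Ch_dual c d \<nu> p w = {\<Lambda>.
    (\<forall>f \<in> Ch c d \<nu> p w. \<forall>g \<in> Ch c d \<nu> p w.
       (AE x in lebesgue_on (einterval c d). f x = g x) \<longrightarrow> \<Lambda> f = \<Lambda> g) \<and>
    (\<forall>f \<in> Ch c d \<nu> p w. \<forall>g \<in> Ch c d \<nu> p w. \<Lambda> (\<lambda>x. f x + g x) = \<Lambda> f + \<Lambda> g) \<and>
    (\<forall>a::real. \<forall>f \<in> Ch c d \<nu> p w. \<Lambda> (\<lambda>x. ereal a * f x) = a * \<Lambda> f) \<and>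
    (\<forall>f \<in> Ch c d \<nu> p w. \<forall>\<epsilon>>0. \<exists>\<delta>>0. \<forall>g \<in> Ch c d \<nu> p w.
       Ch_norm c d \<nu> p w (\<lambda>x. g x - f x) < ereal \<delta> \<longrightarrow> \<bar>\<Lambda> g - \<Lambda> f\<bar> < \<epsilon>)}"

definition Ch_dual_norm ::
  "ereal \<Rightarrow> ereal \<Rightarrow> nat \<Rightarrow> real \<Rightarrow> (real \<Rightarrow> ereal) \<Rightarrow> ((real \<Rightarrow> ereal) \<Rightarrow> real) \<Rightarrow> ereal"
  where "Ch_dual_norm c d \<nu> p w \<Lambda> =
    (SUP f \<in> {f \<in> Ch c d \<nu> p w. Ch_norm c d \<nu> p w f \<le> 1}. ereal \<bar>\<Lambda> f\<bar>)"

definition Lw_norm :: "ereal \<Rightarrow> ereal \<Rightarrow> real \<Rightarrow> (real \<Rightarrow> ereal) \<Rightarrow> (real \<Rightarrow> ereal) \<Rightarrow> ereal"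
  where "Lw_norm c d q u v = Lp_norm q (einterval c d) (\<lambda>x. v x * u x)"

definition Lw :: "ereal \<Rightarrow> ereal \<Rightarrow> real \<Rightarrow> (real \<Rightarrow> ereal) \<Rightarrow> (real \<Rightarrow> ereal) set"
  where "Lw c d q u = {v \<in> meas_fun c d. Lw_norm c d q u v < \<infinity>}"

end

theory Submission
  imports Defs
begin

text \<open>
  Let \<open>T f x = w x * \<integral>\<^bsub>I\<^sub>x\<^esub> f\<close>, where \<open>I\<^sub>x\<close> is the part of \<open>I\<close> on the relevant side of \<open>x\<close>. By the very
  definition of its norm, \<open>Ch\<close> is mapped isometrically into \<open>L\<^sup>p(I)\<close> by the linear map \<open>T\<close>
  (\<open>Ch_isometry\<close>), so a continuous functional \<open>\<Lambda>\<close> on \<open>Ch\<close> is the same thing as a bounded functional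
  on the subspace \<open>T(Ch)\<close> of \<open>L\<^sup>p(I)\<close>. It extends to all of \<open>L\<^sup>p(I)\<close> with the same bound
  \<open>C = \<parallel>\<Lambda>\<parallel>\<close> (\<open>Hahn_Banach_relation\<close>), and the extension is integration against some \<open>u\<close> with
  \<open>\<parallel>u\<parallel> \<le> C\<close> in the dual exponent (\<open>Riesz_representation_Lp\<close>). Hence \<open>\<Lambda> f\<close> is the integral of
  \<open>u x * w x * \<integral>\<^bsub>I\<^sub>x\<^esub> f\<close>, that is, \<open>h = u * w\<close> represents \<open>\<Lambda>\<close>; its weighted norm is \<open>\<parallel>u\<parallel> \<le> \<parallel>\<Lambda>\<parallel>\<close>, and
  Hoelder's inequality gives \<open>\<parallel>\<Lambda>\<parallel> \<le> \<parallel>u\<parallel>\<close>.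

  The extension theorem is proved for spaces of real functions, with the pointwise operations: below
  every sublinear functional there is a minimal one by Zorn's lemma, and minimal sublinear
  functionals are linear.

  For the representation of a bounded functional \<open>\<Phi>\<close> on \<open>L\<^sup>p\<close> of a \<open>\<sigma>\<close>-finite measure, choose a
  strictly positive \<open>k\<close> in \<open>L\<^sup>p\<close>. Then \<open>E \<mapsto> \<Phi> (k * 1\<^sub>E)\<close> is a bounded, countably additive set function
  that vanishes on null sets, so it has an integrable density \<open>r\<close> (\<open>Radon_Nikodym_signed\<close>), and
  \<open>h = r / k\<close> represents \<open>\<Phi>\<close> on all functions dominated by a multiple of \<open>k\<close>. Testing \<open>\<Phi>\<close> on
  truncations of \<open>sgn h * \<bar>h\<bar>\<^bsup>q-1\<^esup>\<close> bounds the norm of \<open>h\<close>, and dominated convergence extends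
  the representation to \<open>L\<^sup>p\<close>.
\<close>

section \<open>Extension of functionals on spaces of functions\<close>

definition function_space :: "('a \<Rightarrow> real) set \<Rightarrow> bool"
  where "function_space X \<longleftrightarrow> (\<lambda>x. 0) \<in> X \<and> (\<forall>g\<in>X. \<forall>h\<in>X. (\<lambda>x. g x + h x) \<in> X) \<and>
    (\<forall>a. \<forall>g\<in>X. (\<lambda>x. a * g x) \<in> X)"

definition linear_functional_on :: "('a \<Rightarrow> real) set \<Rightarrow> (('a \<Rightarrow> real) \<Rightarrow> real) \<Rightarrow> bool"
  where "linear_functional_on X \<Phi> \<longleftrightarrow>
    (\<forall>g\<in>X. \<forall>h\<in>X. \<Phi> (\<lambda>x. g x + h x) = \<Phi> g + \<Phi> h) \<and> (\<forall>a. \<forall>g\<in>X. \<Phi> (\<lambda>x. a * g x) = a * \<Phi> g)"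

definition sublinear_on :: "('a \<Rightarrow> real) set \<Rightarrow> (('a \<Rightarrow> real) \<Rightarrow> real) \<Rightarrow> bool"
  where "sublinear_on X q \<longleftrightarrow>
    (\<forall>g\<in>X. \<forall>h\<in>X. q (\<lambda>x. g x + h x) \<le> q g + q h) \<and>
    (\<forall>a\<ge>0. \<forall>g\<in>X. q (\<lambda>x. a * g x) \<le> a * q g)"

lemma function_space_add: "function_space X \<Longrightarrow> g \<in> X \<Longrightarrow> h \<in> X \<Longrightarrow> (\<lambda>x. g x + h x) \<in> X"
  and function_space_scale: "function_space X \<Longrightarrow> g \<in> X \<Longrightarrow> (\<lambda>x. a * g x) \<in> X"
  and function_space_zero: "function_space X \<Longrightarrow> (\<lambda>x. 0) \<in> X"
  unfolding function_space_def by auto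

lemma function_space_uminus: "function_space X \<Longrightarrow> g \<in> X \<Longrightarrow> (\<lambda>x. - g x) \<in> X"
  using function_space_scale[of X g "-1"] by simp

lemma function_space_diff: "function_space X \<Longrightarrow> g \<in> X \<Longrightarrow> h \<in> X \<Longrightarrow> (\<lambda>x. g x - h x) \<in> X"
  using function_space_add[of X g "\<lambda>x. - h x"] function_space_uminus[of X h] by simp

lemma linear_functional_add:
    "linear_functional_on X \<Phi> \<Longrightarrow> g \<in> X \<Longrightarrow> h \<in> X \<Longrightarrow> \<Phi> (\<lambda>x. g x + h x) = \<Phi> g + \<Phi> h"
  and linear_functional_scale:
    "linear_functional_on X \<Phi> \<Longrightarrow> g \<in> X \<Longrightarrow> \<Phi> (\<lambda>x. a * g x) = a * \<Phi> g"
  unfolding linear_functional_on_def by auto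

lemma linear_functional_diff:
  assumes "function_space X" "linear_functional_on X \<Phi>" "g \<in> X" "h \<in> X"
  shows "\<Phi> (\<lambda>x. g x - h x) = \<Phi> g - \<Phi> h"
  using linear_functional_add[OF assms(2) function_space_diff[OF assms(1,3,4)] assms(4)] by simp

lemma sublinear_add: "sublinear_on X q \<Longrightarrow> g \<in> X \<Longrightarrow> h \<in> X \<Longrightarrow> q (\<lambda>x. g x + h x) \<le> q g + q h"
  and sublinear_scale_le: "sublinear_on X q \<Longrightarrow> 0 \<le> a \<Longrightarrow> g \<in> X \<Longrightarrow> q (\<lambda>x. a * g x) \<le> a * q g"
  unfolding sublinear_on_def by auto

lemma sublinear_zero:
  assumes "function_space X" "sublinear_on X q"
  shows "q (\<lambda>x. 0) = 0"
proof (rule antisym)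
  have z: "(\<lambda>x. 0) \<in> X" by (rule function_space_zero[OF assms(1)])
  show "q (\<lambda>x. 0) \<le> 0" using sublinear_scale_le[OF assms(2) _ z, of 0] by simp
  show "0 \<le> q (\<lambda>x. 0)" using sublinear_add[OF assms(2) z z] by simp
qed

lemma sublinear_scale:
  assumes X: "function_space X" and q: "sublinear_on X q" and a: "0 \<le> a" and g: "g \<in> X"
  shows "q (\<lambda>x. a * g x) = a * q g"
proof (cases "a = 0")
  case True
  then show ?thesis using sublinear_zero[OF X q] by simp
next
  case False
  have "q (\<lambda>x. (1 / a) * (a * g x)) \<le> (1 / a) * q (\<lambda>x. a * g x)"
    using a by (intro sublinear_scale_le[OF q] function_space_scale[OF X] g) auto
  then have "a * q g \<le> q (\<lambda>x. a * g x)"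
    using False a by (simp add: field_simps)
  with sublinear_scale_le[OF q a g] show ?thesis by simp
qed

lemma sublinear_uminus_lower:
  assumes X: "function_space X" and q: "sublinear_on X q" and g: "g \<in> X"
  shows "- q (\<lambda>x. - g x) \<le> q g"
  using sublinear_add[OF q g function_space_uminus[OF X g]] sublinear_zero[OF X q] by simp

lemma le_mult_cINF:
  fixes f :: "'b \<Rightarrow> real"
  assumes "A \<noteq> {}" "0 \<le> a" "\<And>s. s \<in> A \<Longrightarrow> b \<le> a * f s"
  shows "b \<le> a * (INF s\<in>A. f s)"
proof (cases "a = 0")
  case True
  then show ?thesis using assms by auto
next
  case False
  then have "b / a \<le> (INF s\<in>A. f s)"
    using assms by (intro cINF_greatest) (auto simp: field_simps)
  then show ?thesis using False assms(2) by (simp add: field_simps)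
qed

lemma le_cINF_add:
  fixes f :: "'b \<Rightarrow> real" and g :: "'c \<Rightarrow> real"
  assumes "A \<noteq> {}" "B \<noteq> {}" "\<And>s t. s \<in> A \<Longrightarrow> t \<in> B \<Longrightarrow> b \<le> f s + g t"
  shows "b \<le> (INF s\<in>A. f s) + (INF t\<in>B. g t)"
proof -
  have "b - f s \<le> (INF t\<in>B. g t)" if "s \<in> A" for s
  proof (rule cINF_greatest[OF assms(2)])
    fix t assume "t \<in> B"
    with assms(3)[OF that this] show "b - f s \<le> g t" by linarith
  qed
  then have "b - (INF t\<in>B. g t) \<le> (INF s\<in>A. f s)"
    by (intro cINF_greatest[OF assms(1)]) (auto simp: algebra_simps)
  then show ?thesis by linarith
qed

text \<open>
  The value outside \<open>X\<close> is normalised so that the pointwise order is antisymmetric on these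
  functionals.
\<close>

definition sublinear_below :: "('a \<Rightarrow> real) set \<Rightarrow> (('a \<Rightarrow> real) \<Rightarrow> real) \<Rightarrow> (('a \<Rightarrow> real) \<Rightarrow> real) set"
  where "sublinear_below X q\<^sub>0 =
    {q. sublinear_on X q \<and> (\<forall>g\<in>X. q g \<le> q\<^sub>0 g) \<and> (\<forall>g. g \<notin> X \<longrightarrow> q g = 0)}"

text \<open>
  A chain has its pointwise infimum as a lower bound: the infimum is finite since
  \<open>q g \<ge> - q (- g) \<ge> - q\<^sub>0 (- g)\<close>, and it is subadditive since of two members of the chain the smaller
  one can be used for both summands.
\<close>

lemma minimal_sublinear_exists:
  assumes X: "function_space X" and q0: "sublinear_on X q\<^sub>0"
  shows "\<exists>m\<in>sublinear_below X q\<^sub>0. \<forall>q\<in>sublinear_below X q\<^sub>0. (\<forall>g. q g \<le> m g) \<longrightarrow> q = m"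
proof (rule predicate_Zorn)
  let ?A = "sublinear_below X q\<^sub>0"
  let ?P = "\<lambda>q r. \<forall>g. r g \<le> (q g :: real)"
  show "partial_order_on ?A (relation_of ?P ?A)"
    by (rule partial_order_on_relation_ofI) (auto simp: fun_eq_iff intro: order_trans antisym)
  fix C assume C: "C \<in> Chains (relation_of ?P ?A)"
  have CA: "q \<in> ?A" if "q \<in> C" for q
    using C that unfolding Chains_def relation_of_def by auto
  have chain: "?P q r \<or> ?P r q" if "q \<in> C" "r \<in> C" for q r
    using C that unfolding Chains_def relation_of_def by auto
  show "\<exists>u\<in>?A. \<forall>q\<in>C. ?P q u"
  proof (cases "C = {}")
    case True
    have "(\<lambda>g. if g \<in> X then q\<^sub>0 g else 0) \<in> ?A"
      using q0 function_space_add[OF X] function_space_scale[OF X]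
      unfolding sublinear_below_def sublinear_on_def by auto
    with True show ?thesis by blast
  next
    case False
    define u where "u g = (INF q\<in>C. q g)" for g
    have sub: "sublinear_on X q" if "q \<in> C" for q
      using CA[OF that] unfolding sublinear_below_def by auto
    have below: "q g \<le> q\<^sub>0 g" if "q \<in> C" "g \<in> X" for q g
      using CA[OF that(1)] that(2) unfolding sublinear_below_def by auto
    have out: "q g = 0" if "q \<in> C" "g \<notin> X" for q g
      using CA[OF that(1)] that(2) unfolding sublinear_below_def by auto
    have bdd: "bdd_below ((\<lambda>q. q g) ` C)" for g
    proof (cases "g \<in> X")
      case True
      have "- q\<^sub>0 (\<lambda>x. - g x) \<le> q g" if "q \<in> C" for q
        using sublinear_uminus_lower[OF X sub[OF that] True]
          below[OF that function_space_uminus[OF X True]] by linarith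
      then show ?thesis by (auto simp: bdd_below_def)
    next
      case False
      show ?thesis by (rule bdd_belowI2[of C 0]) (simp add: out False)
    qed
    have u_le: "u g \<le> q g" if "q \<in> C" for q g
      unfolding u_def using bdd that by (rule cINF_lower)
    have u_add: "u (\<lambda>x. g x + h x) \<le> u g + u h" if gh: "g \<in> X" "h \<in> X" for g h
    proof -
      have "u (\<lambda>x. g x + h x) \<le> q g + r h" if qr: "q \<in> C" "r \<in> C" for q r
      proof -
        obtain s where s: "s \<in> C" "\<And>g. s g \<le> q g" "\<And>g. s g \<le> r g"
          using chain[OF qr] qr by blast
        have "u (\<lambda>x. g x + h x) \<le> s g + s h"
          using u_le[OF s(1)] sublinear_add[OF sub[OF s(1)] gh] by (rule order_trans)
        with s(2)[of g] s(3)[of h] show ?thesis by linarith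
      qed
      then show ?thesis unfolding u_def[of g] u_def[of h] by (intro le_cINF_add False)
    qed
    have u_scale: "u (\<lambda>x. a * g x) \<le> a * u g" if ag: "0 \<le> a" "g \<in> X" for a g
      unfolding u_def[of g]
      by (rule le_mult_cINF[OF False ag(1)])
        (use u_le sublinear_scale_le[OF sub ag] order_trans in blast)
    obtain q1 where q1: "q1 \<in> C" using False by blast
    have "u \<in> ?A"
      unfolding sublinear_below_def sublinear_on_def
    proof (intro CollectI conjI ballI allI impI)
      show "u g \<le> q\<^sub>0 g" if "g \<in> X" for g
        using u_le[OF q1] below[OF q1 that] by (rule order_trans)
      show "u g = 0" if "g \<notin> X" for g
      proof -
        have "(INF q\<in>C. q g) = (INF q\<in>C. 0)" by (rule INF_cong) (simp_all add: out that)
        then show ?thesis using False by (simp add: u_def)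
      qed
    qed (use u_add u_scale in auto)
    with u_le show ?thesis by blast
  qed
qed

text \<open>
  For fixed \<open>y\<close>, the infimum over \<open>t \<ge> 0\<close> of \<open>m (g + t y) - t * m y\<close> is again sublinear in \<open>g\<close>
  and lies below \<open>m\<close>, hence equals \<open>m\<close>. Comparing with \<open>t = 1\<close> gives superadditivity.
\<close>

lemma minimal_sublinear_linear:
  assumes X: "function_space X" and m: "m \<in> sublinear_below X q\<^sub>0"
    and min: "\<And>q. q \<in> sublinear_below X q\<^sub>0 \<Longrightarrow> (\<And>g. q g \<le> m g) \<Longrightarrow> q = m"
  shows "linear_functional_on X m"
proof -
  have sub: "sublinear_on X m" and below: "\<And>g. g \<in> X \<Longrightarrow> m g \<le> q\<^sub>0 g"
    and out: "\<And>g. g \<notin> X \<Longrightarrow> m g = 0"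
    using m unfolding sublinear_below_def by auto
  have superadd: "m g + m y \<le> m (\<lambda>x. g x + y x)" if g: "g \<in> X" and y: "y \<in> X" for g y
  proof -
    let ?T = "\<lambda>t g. m (\<lambda>x. g x + t * y x) - t * m y"
    define u where "u g = (if g \<in> X then INF t\<in>{0::real..}. ?T t g else 0)" for g
    have bdd: "bdd_below ((\<lambda>t. ?T t g) ` {0..})" if g: "g \<in> X" for g
    proof -
      have "- m (\<lambda>x. - g x) \<le> ?T t g" if "0 \<le> t" for t
      proof -
        have ty: "(\<lambda>x. t * y x) \<in> X" using X y by (rule function_space_scale)
        have "m (\<lambda>x. (g x + t * y x) + - g x) \<le> m (\<lambda>x. g x + t * y x) + m (\<lambda>x. - g x)"
          by (intro sublinear_add[OF sub] function_space_add[OF X] function_space_uminus[OF X] g ty)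
        then show ?thesis using sublinear_scale[OF X sub that y] by simp
      qed
      then show ?thesis unfolding bdd_below_def by auto
    qed
    have u_le: "u g \<le> ?T t g" if "g \<in> X" "0 \<le> t" for t g
      using cINF_lower[OF bdd[OF that(1)]] that unfolding u_def by auto
    have u_m: "u g \<le> m g" for g
      using u_le[of g 0] out[of g] by (cases "g \<in> X") (auto simp: u_def)
    have u_add: "u (\<lambda>x. g x + h x) \<le> u g + u h" if gh: "g \<in> X" "h \<in> X" for g h
    proof -
      have "u (\<lambda>x. g x + h x) \<le> ?T s g + ?T t h" if st: "s \<in> {0..}" "t \<in> {0..}" for s t
      proof -
        have "u (\<lambda>x. g x + h x) \<le> ?T (s + t) (\<lambda>x. g x + h x)"
          using st by (intro u_le function_space_add[OF X gh]) auto
        moreover have "m (\<lambda>x. (g x + s * y x) + (h x + t * y x)) \<le>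
            m (\<lambda>x. g x + s * y x) + m (\<lambda>x. h x + t * y x)"
          by (intro sublinear_add[OF sub] function_space_add[OF X] gh function_space_scale[OF X] y)
        ultimately show ?thesis by (simp add: algebra_simps)
      qed
      then show ?thesis
        using gh le_cINF_add[of "{0..}" "{0..}" _ "\<lambda>s. ?T s g" "\<lambda>t. ?T t h"]
        unfolding u_def[of g] u_def[of h] by auto
    qed
    have u_scale: "u (\<lambda>x. a * g x) \<le> a * u g" if ag: "0 \<le> a" "g \<in> X" for a g
    proof -
      have "u (\<lambda>x. a * g x) \<le> a * ?T t g" if t: "t \<in> {0..}" for t
      proof -
        have "u (\<lambda>x. a * g x) \<le> ?T (a * t) (\<lambda>x. a * g x)"
          using t ag by (intro u_le function_space_scale[OF X ag(2)]) auto
        moreover have "m (\<lambda>x. a * (g x + t * y x)) \<le> a * m (\<lambda>x. g x + t * y x)"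
          by (intro sublinear_scale_le[OF sub ag(1)] function_space_add[OF X]
              function_space_scale[OF X] ag y)
        ultimately show ?thesis by (simp add: algebra_simps)
      qed
      then show ?thesis
        using ag le_mult_cINF[of "{0..}" a _ "\<lambda>t. ?T t g"] unfolding u_def[of g] by auto
    qed
    have "u \<in> sublinear_below X q\<^sub>0"
      unfolding sublinear_below_def sublinear_on_def
      using u_add u_scale order_trans[OF u_m below] by (auto simp: u_def)
    then have "u = m" using u_m by (rule min)
    then show ?thesis using u_le[OF g, of 1] by simp
  qed
  have add: "m (\<lambda>x. g x + h x) = m g + m h" if "g \<in> X" "h \<in> X" for g h
    using superadd[OF that] sublinear_add[OF sub that] by (rule antisym[rotated])
  have "m (\<lambda>x. a * g x) = a * m g" if g: "g \<in> X" for a g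
  proof (cases "0 \<le> a")
    case True
    then show ?thesis by (rule sublinear_scale[OF X sub _ g])
  next
    case False
    have "m (\<lambda>x. a * g x + (- a) * g x) = m (\<lambda>x. a * g x) + m (\<lambda>x. (- a) * g x)"
      by (intro add function_space_scale[OF X g])
    then show ?thesis
      using sublinear_scale[OF X sub _ g, of "- a"] sublinear_zero[OF X sub] False by simp
  qed
  with add show ?thesis unfolding linear_functional_on_def by auto
qed

lemma linear_functional_below_sublinear:
  assumes X: "function_space X" and q0: "sublinear_on X q\<^sub>0"
  obtains \<Phi> where "linear_functional_on X \<Phi>" "\<And>g. g \<in> X \<Longrightarrow> \<Phi> g \<le> q\<^sub>0 g"
proof -
  obtain m where m: "m \<in> sublinear_below X q\<^sub>0"
    and min: "\<And>q. q \<in> sublinear_below X q\<^sub>0 \<Longrightarrow> (\<And>g. q g \<le> m g) \<Longrightarrow> q = m"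
    using minimal_sublinear_exists[OF assms] by blast
  show thesis
    using minimal_sublinear_linear[OF X m min] m
    by (intro that) (auto simp: sublinear_below_def)
qed

text \<open>
  A pair \<open>(v, t)\<close> in \<open>R\<close> prescribes the value \<open>t\<close> at \<open>v\<close>; a relation is convenient when the
  subspace is given as the image of a linear map. The functional is found below the sublinear
  functional \<open>q g = inf {N (g - v) + t | (v, t) \<in> R}\<close>. Taking \<open>(v, t) = (0, 0)\<close> shows \<open>q \<le> N\<close>, and
  \<open>q v \<le> t\<close> together with \<open>q (- v) \<le> - t\<close> forces the value \<open>t\<close> at \<open>v\<close>.
\<close>

lemma Hahn_Banach_relation:
  fixes N :: "('a \<Rightarrow> real) \<Rightarrow> real"
  assumes X: "function_space X" and N: "sublinear_on X N"
    and R0: "((\<lambda>x. 0), 0) \<in> R"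
    and RX: "\<And>v t. (v, t) \<in> R \<Longrightarrow> v \<in> X"
    and Radd: "\<And>v t v' t'. (v, t) \<in> R \<Longrightarrow> (v', t') \<in> R \<Longrightarrow> ((\<lambda>x. v x + v' x), t + t') \<in> R"
    and Rscale: "\<And>a v t. (v, t) \<in> R \<Longrightarrow> ((\<lambda>x. a * v x), a * t) \<in> R"
    and bound: "\<And>v t. (v, t) \<in> R \<Longrightarrow> t \<le> N v"
  obtains \<Phi> where "linear_functional_on X \<Phi>" "\<And>v t. (v, t) \<in> R \<Longrightarrow> \<Phi> v = t"
    "\<And>g. g \<in> X \<Longrightarrow> \<Phi> g \<le> N g"
proof -
  let ?T = "\<lambda>g r. N (\<lambda>x. g x - fst r x) + snd r"
  define q where "q g = (INF r\<in>R. ?T g r)" for g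
  have ne: "R \<noteq> {}" using R0 by blast
  have bdd: "bdd_below (?T g ` R)" if g: "g \<in> X" for g
  proof -
    have "- N (\<lambda>x. - g x) \<le> ?T g r" if r: "r \<in> R" for r
    proof -
      obtain v t where vt: "r = (v, t)" by (cases r)
      have Rm: "((\<lambda>x. -1 * v x), -1 * t) \<in> R" using r vt by (intro Rscale) auto
      have vX: "v \<in> X" using RX r vt by blast
      have "N (\<lambda>x. (g x - v x) + (- g x)) \<le> N (\<lambda>x. g x - v x) + N (\<lambda>x. - g x)"
        by (intro sublinear_add[OF N] function_space_diff[OF X] function_space_uminus[OF X] g vX)
      then show ?thesis using bound[OF Rm] vt by simp
    qed
    then show ?thesis by (intro bdd_belowI2)
  qed
  have q_le: "q g \<le> N (\<lambda>x. g x - v x) + t" if "g \<in> X" "(v, t) \<in> R" for g v t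
    using cINF_lower[OF bdd[OF that(1)] that(2)] unfolding q_def by simp
  have q_add: "q (\<lambda>x. g x + h x) \<le> q g + q h" if gh: "g \<in> X" "h \<in> X" for g h
    unfolding q_def[of g] q_def[of h]
  proof (intro le_cINF_add ne)
    fix r s assume rs: "r \<in> R" "s \<in> R"
    obtain v t v' t' where vt: "r = (v, t)" "s = (v', t')" by (cases r, cases s)
    have vX: "v \<in> X" "v' \<in> X" using RX rs vt by blast+
    have "q (\<lambda>x. g x + h x) \<le> N (\<lambda>x. (g x + h x) - (v x + v' x)) + (t + t')"
      using rs vt by (intro q_le Radd function_space_add[OF X] gh) auto
    moreover have "N (\<lambda>x. (g x - v x) + (h x - v' x)) \<le> N (\<lambda>x. g x - v x) + N (\<lambda>x. h x - v' x)"
      by (intro sublinear_add[OF N] function_space_diff[OF X] gh vX)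
    ultimately show "q (\<lambda>x. g x + h x) \<le> ?T g r + ?T h s"
      using vt by (simp add: algebra_simps)
  qed
  have q_scale: "q (\<lambda>x. a * g x) \<le> a * q g" if ag: "0 \<le> a" "g \<in> X" for a g
    unfolding q_def[of g]
  proof (intro le_mult_cINF ne ag(1))
    fix r assume r: "r \<in> R"
    obtain v t where vt: "r = (v, t)" by (cases r)
    have vX: "v \<in> X" using RX r vt by blast
    have "q (\<lambda>x. a * g x) \<le> N (\<lambda>x. a * g x - a * v x) + a * t"
      using r vt by (intro q_le Rscale function_space_scale[OF X] ag) auto
    moreover have "N (\<lambda>x. a * (g x - v x)) \<le> a * N (\<lambda>x. g x - v x)"
      by (intro sublinear_scale_le[OF N] function_space_diff[OF X] ag vX)
    ultimately show "q (\<lambda>x. a * g x) \<le> a * ?T g r"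
      using vt by (simp add: algebra_simps)
  qed
  have "sublinear_on X q" unfolding sublinear_on_def using q_add q_scale by auto
  from linear_functional_below_sublinear[OF X this] obtain \<Phi>
    where lin: "linear_functional_on X \<Phi>" and le: "\<And>g. g \<in> X \<Longrightarrow> \<Phi> g \<le> q g" by blast
  have le_t: "\<Phi> v \<le> t" if "(v, t) \<in> R" for v t
    using le[OF RX[OF that]] q_le[OF RX[OF that] that] sublinear_zero[OF X N] by simp
  have "\<Phi> v = t" if vt: "(v, t) \<in> R" for v t
  proof (rule antisym[OF le_t[OF vt]])
    from le_t[OF Rscale[OF vt, of "-1"]] linear_functional_scale[OF lin RX[OF vt], of "-1"] show "t \<le> \<Phi> v" by simp
  qed
  moreover have "\<Phi> g \<le> N g" if "g \<in> X" for g
    using le[OF that] q_le[OF that R0] by simp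
  ultimately show thesis using lin that by blast
qed

section \<open>The spaces of p-integrable functions\<close>

text \<open>
  On the boundary of the half line convexity reduces to \<open>(r c)\<^sup>p \<le> r c\<^sup>p\<close> for \<open>r \<le> 1\<close>.
\<close>

lemma powr_convex_nonneg:
  fixes a b s p :: real
  assumes p: "1 \<le> p" and ab: "0 \<le> a" "0 \<le> b" and s: "0 \<le> s" "s \<le> 1"
  shows "(s * a + (1 - s) * b) powr p \<le> s * a powr p + (1 - s) * b powr p"
proof -
  have scaled: "(r * c) powr p \<le> r * c powr p" if "0 \<le> r" "r \<le> 1" "0 \<le> c" for r c :: real
  proof -
    have "r powr p \<le> r"
      using powr_mono'[OF p that(1,2)] that by (cases "r = 0") auto
    then show ?thesis using that by (auto simp: powr_mult intro!: mult_right_mono)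
  qed
  show ?thesis
  proof (cases "a = 0 \<or> b = 0")
    case True
    then show ?thesis using scaled[of s a] scaled[of "1 - s" b] p ab s by auto
  next
    case False
    then show ?thesis
      using convex_onD[OF powr_convex[OF p], of "1 - s" a b] ab s by simp
  qed
qed

definition Lp_fun :: "'a measure \<Rightarrow> real \<Rightarrow> ('a \<Rightarrow> real) set"
  where "Lp_fun M p = {g \<in> borel_measurable M. integrable M (\<lambda>x. \<bar>g x\<bar> powr p)}"

definition Lp_seminorm :: "'a measure \<Rightarrow> real \<Rightarrow> ('a \<Rightarrow> real) \<Rightarrow> real"
  where "Lp_seminorm M p g = (LINT x|M. \<bar>g x\<bar> powr p) powr (1 / p)"

lemma Lp_funD:
  "g \<in> Lp_fun M p \<Longrightarrow> g \<in> borel_measurable M"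
  "g \<in> Lp_fun M p \<Longrightarrow> integrable M (\<lambda>x. \<bar>g x\<bar> powr p)"
  by (auto simp: Lp_fun_def)

lemma Lp_fun_dominated:
  assumes "h \<in> Lp_fun M p" "g \<in> borel_measurable M" "0 < p" "AE x in M. \<bar>g x\<bar> \<le> K * \<bar>h x\<bar>" "0 \<le> K"
  shows "g \<in> Lp_fun M p"
proof -
  have "integrable M (\<lambda>x. K powr p * \<bar>h x\<bar> powr p)"
    using Lp_funD(2)[OF assms(1)] by simp
  then have "integrable M (\<lambda>x. \<bar>g x\<bar> powr p)"
  proof (rule Bochner_Integration.integrable_bound)
    show "AE x in M. norm (\<bar>g x\<bar> powr p) \<le> norm (K powr p * \<bar>h x\<bar> powr p)"
      using assms(4)
    proof eventually_elim
      case (elim x)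
      then have "\<bar>g x\<bar> powr p \<le> (K * \<bar>h x\<bar>) powr p"
        using assms(3) by (intro powr_mono2) auto
      then show ?case using assms(5) by (simp add: powr_mult)
    qed
  qed (use assms in measurable)
  with assms(2) show ?thesis by (simp add: Lp_fun_def)
qed

lemma Lp_seminorm_nonneg [simp]: "0 \<le> Lp_seminorm M p g"
  by (simp add: Lp_seminorm_def)

text \<open>
  This form of a bound on the norm avoids roots in the proofs of the inequalities of Minkowski
  and Hoelder.
\<close>

lemma Lp_seminorm_le_iff:
  assumes "0 < p" "0 \<le> a"
  shows "Lp_seminorm M p g \<le> a \<longleftrightarrow> (LINT x|M. \<bar>g x\<bar> powr p) \<le> a powr p"
proof -
  let ?I = "LINT x|M. \<bar>g x\<bar> powr p"
  have nn: "0 \<le> ?I" by (intro integral_nonneg_AE) auto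
  have "?I powr (1 / p) \<le> a \<longleftrightarrow> (?I powr (1 / p)) powr p \<le> a powr p"
    using assms by (auto intro: powr_mono2 powr_less_mono2 simp: not_le[symmetric] dest: leD)
       (metis linorder_not_less powr_ge_zero powr_less_mono2)
  also have "(?I powr (1 / p)) powr p = ?I"
    using nn assms by (simp add: powr_powr)
  finally show ?thesis by (simp add: Lp_seminorm_def)
qed

lemma Lp_seminorm_cong_AE:
  assumes "AE x in M. \<bar>g x\<bar> = \<bar>h x\<bar>" "g \<in> borel_measurable M" "h \<in> borel_measurable M"
  shows "Lp_seminorm M p g = Lp_seminorm M p h"
proof -
  have "(LINT x|M. \<bar>g x\<bar> powr p) = (LINT x|M. \<bar>h x\<bar> powr p)"
    using assms by (intro integral_cong_AE) auto
  then show ?thesis by (simp add: Lp_seminorm_def)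
qed

lemma Lp_seminorm_scale:
  assumes "0 < p"
  shows "Lp_seminorm M p (\<lambda>x. a * g x) = \<bar>a\<bar> * Lp_seminorm M p g"
proof -
  have nn: "0 \<le> (LINT x|M. \<bar>g x\<bar> powr p)" by (intro integral_nonneg_AE) auto
  have "(LINT x|M. \<bar>a * g x\<bar> powr p) = \<bar>a\<bar> powr p * (LINT x|M. \<bar>g x\<bar> powr p)"
    by (simp add: abs_mult powr_mult)
  then show ?thesis using assms nn by (simp add: Lp_seminorm_def powr_mult powr_powr)
qed

lemma function_space_Lp_fun:
  assumes p: "1 \<le> p"
  shows "function_space (Lp_fun M p)"
  unfolding function_space_def
proof (intro conjI ballI allI)
  show "(\<lambda>x. 0) \<in> Lp_fun M p" by (simp add: Lp_fun_def)
next
  fix g h assume gh: "g \<in> Lp_fun M p" "h \<in> Lp_fun M p"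
  note [measurable] = Lp_funD(1)[OF gh(1)] Lp_funD(1)[OF gh(2)]
  have "integrable M (\<lambda>x. 2 powr p * (1 / 2 * \<bar>g x\<bar> powr p + (1 - 1 / 2) * \<bar>h x\<bar> powr p))"
    using Lp_funD(2)[OF gh(1)] Lp_funD(2)[OF gh(2)] by simp
  then have "integrable M (\<lambda>x. \<bar>g x + h x\<bar> powr p)"
  proof (rule Bochner_Integration.integrable_bound)
    have "norm (\<bar>g x + h x\<bar> powr p) \<le>
        norm (2 powr p * (1 / 2 * \<bar>g x\<bar> powr p + (1 - 1 / 2) * \<bar>h x\<bar> powr p))" for x
    proof -
      have "\<bar>g x + h x\<bar> powr p \<le> (2 * (1 / 2 * \<bar>g x\<bar> + (1 - 1 / 2) * \<bar>h x\<bar>)) powr p"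
        using p by (intro powr_mono2) auto
      also have "\<dots> = 2 powr p * (1 / 2 * \<bar>g x\<bar> + (1 - 1 / 2) * \<bar>h x\<bar>) powr p"
        by (subst powr_mult) auto
      also have "\<dots> \<le> 2 powr p * (1 / 2 * \<bar>g x\<bar> powr p + (1 - 1 / 2) * \<bar>h x\<bar> powr p)"
        using p by (intro mult_left_mono powr_convex_nonneg) auto
      finally show ?thesis by simp
    qed
    then show "AE x in M. norm (\<bar>g x + h x\<bar> powr p) \<le>
        norm (2 powr p * (1 / 2 * \<bar>g x\<bar> powr p + (1 - 1 / 2) * \<bar>h x\<bar> powr p))" by simp
  qed measurable
  then show "(\<lambda>x. g x + h x) \<in> Lp_fun M p" by (simp add: Lp_fun_def)
next
  fix a g assume g: "g \<in> Lp_fun M p"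
  show "(\<lambda>x. a * g x) \<in> Lp_fun M p"
    using p Lp_funD[OF g] by (intro Lp_fun_dominated[OF g, of _ "\<bar>a\<bar>"]) (auto simp: abs_mult)
qed

text \<open>
  For \<open>a > \<parallel>g\<parallel>\<close> and \<open>b > \<parallel>h\<parallel>\<close>, the sum \<open>(g + h) / (a + b)\<close> is a convex combination of \<open>g / a\<close> and
  \<open>h / b\<close>, whose norms are at most 1. The strict inequalities keep the denominators positive even
  when one of the functions vanishes almost everywhere; they are removed by letting \<open>e\<close> tend to 0.
\<close>

lemma Minkowski_inequality:
  assumes p: "1 \<le> p" and g: "g \<in> Lp_fun M p" and h: "h \<in> Lp_fun M p"
  shows "Lp_seminorm M p (\<lambda>x. g x + h x) \<le> Lp_seminorm M p g + Lp_seminorm M p h"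
proof (rule field_le_epsilon)
  fix e :: real assume e: "0 < e"
  define a where "a = Lp_seminorm M p g + e / 2"
  define b where "b = Lp_seminorm M p h + e / 2"
  define s where "s = a / (a + b)"
  have ab: "0 < a" "0 < b" using e by (auto simp: a_def b_def intro: add_nonneg_pos)
  have s: "0 \<le> s" "s \<le> 1" and s_eq: "(a + b) * s = a" "(a + b) * (1 - s) = b"
    using ab by (auto simp: s_def field_simps)
  have ga: "(LINT x|M. \<bar>g x\<bar> powr p) \<le> a powr p" and hb: "(LINT x|M. \<bar>h x\<bar> powr p) \<le> b powr p"
    using Lp_seminorm_le_iff[of p a M g] Lp_seminorm_le_iff[of p b M h] p e ab
    by (auto simp: a_def b_def)
  have gh: "(\<lambda>x. g x + h x) \<in> Lp_fun M p"
    using function_space_add[OF function_space_Lp_fun[OF p] g h] .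
  have pw: "\<bar>g x + h x\<bar> powr p \<le>
      (a + b) powr p * (s * (\<bar>g x\<bar> powr p / a powr p) + (1 - s) * (\<bar>h x\<bar> powr p / b powr p))" for x
  proof -
    have "\<bar>g x + h x\<bar> \<le> \<bar>g x\<bar> + \<bar>h x\<bar>" by simp
    also have "\<bar>g x\<bar> + \<bar>h x\<bar> = (a + b) * (s * (\<bar>g x\<bar> / a) + (1 - s) * (\<bar>h x\<bar> / b))"
      using ab by (simp add: distrib_left[of "a + b"] mult.assoc[symmetric] s_eq)
    finally have "\<bar>g x + h x\<bar> powr p \<le>
        ((a + b) * (s * (\<bar>g x\<bar> / a) + (1 - s) * (\<bar>h x\<bar> / b))) powr p"
      using p by (intro powr_mono2) auto
    also have "\<dots> = (a + b) powr p * (s * (\<bar>g x\<bar> / a) + (1 - s) * (\<bar>h x\<bar> / b)) powr p"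
      by (rule powr_mult)
    also have "\<dots> \<le> (a + b) powr p * (s * (\<bar>g x\<bar> / a) powr p + (1 - s) * (\<bar>h x\<bar> / b) powr p)"
      using p ab s by (intro mult_left_mono powr_convex_nonneg) auto
    finally show ?thesis using ab by (simp add: powr_divide)
  qed
  have "(LINT x|M. \<bar>g x + h x\<bar> powr p) \<le> (LINT x|M. (a + b) powr p *
      (s * (\<bar>g x\<bar> powr p / a powr p) + (1 - s) * (\<bar>h x\<bar> powr p / b powr p)))"
    using Lp_funD(2)[OF g] Lp_funD(2)[OF h] Lp_funD(2)[OF gh] pw by (intro integral_mono) auto
  also have "\<dots> = (a + b) powr p * (s * ((LINT x|M. \<bar>g x\<bar> powr p) / a powr p) +
      (1 - s) * ((LINT x|M. \<bar>h x\<bar> powr p) / b powr p))"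
    using Lp_funD(2)[OF g] Lp_funD(2)[OF h] by simp
  also have "\<dots> \<le> (a + b) powr p * (s * 1 + (1 - s) * 1)"
    using s ab ga hb by (intro mult_left_mono add_mono) (auto simp: field_simps)
  finally have "(LINT x|M. \<bar>g x + h x\<bar> powr p) \<le> (a + b) powr p" by simp
  then have "Lp_seminorm M p (\<lambda>x. g x + h x) \<le> a + b"
    using Lp_seminorm_le_iff[of p "a + b" M "\<lambda>x. g x + h x"] p ab by simp
  then show "Lp_seminorm M p (\<lambda>x. g x + h x) \<le> Lp_seminorm M p g + Lp_seminorm M p h + e"
    by (simp add: a_def b_def)
qed

lemma sublinear_on_Lp_seminorm:
  assumes "1 \<le> p" "0 \<le> C"
  shows "sublinear_on (Lp_fun M p) (\<lambda>g. C * Lp_seminorm M p g)"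
  unfolding sublinear_on_def
proof (intro conjI ballI allI impI)
  fix g h assume "g \<in> Lp_fun M p" "h \<in> Lp_fun M p"
  from mult_left_mono[OF Minkowski_inequality[OF assms(1) this] assms(2)]
  show "C * Lp_seminorm M p (\<lambda>x. g x + h x) \<le> C * Lp_seminorm M p g + C * Lp_seminorm M p h"
    by (simp add: algebra_simps)
qed (use assms in \<open>auto simp: Lp_seminorm_scale\<close>)

text \<open>
  Young's inequality applied to \<open>g / a\<close> and \<open>h / b\<close>, where again \<open>a\<close> and \<open>b\<close> exceed the norms by
  \<open>e\<close>.
\<close>

lemma Hoelder_inequality:
  assumes p: "1 < p" "1 < q" "1 / p + 1 / q = 1" and g: "g \<in> Lp_fun M p" and h: "h \<in> Lp_fun M q"
  shows "integrable M (\<lambda>x. g x * h x)"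
    and "(LINT x|M. \<bar>g x * h x\<bar>) \<le> Lp_seminorm M p g * Lp_seminorm M q h"
proof -
  note [measurable] = Lp_funD(1)[OF g] Lp_funD(1)[OF h]
  have young: "\<bar>g x * h x\<bar> \<le> a * b * (\<bar>g x\<bar> powr p / a powr p / p + \<bar>h x\<bar> powr q / b powr q / q)"
    if ab: "0 < a" "0 < b" for a b x
  proof -
    have "(\<bar>g x\<bar> / a) * (\<bar>h x\<bar> / b) \<le> (\<bar>g x\<bar> / a) powr p / p + (\<bar>h x\<bar> / b) powr q / q"
      using ab by (intro Youngs_inequality p) auto
    with ab show ?thesis by (simp add: powr_divide abs_mult field_simps)
  qed
  have dom: "integrable M (\<lambda>x. a * b * (\<bar>g x\<bar> powr p / a powr p / p + \<bar>h x\<bar> powr q / b powr q / q))"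
    for a b using Lp_funD(2)[OF g] Lp_funD(2)[OF h] by simp
  show int: "integrable M (\<lambda>x. g x * h x)"
    by (rule Bochner_Integration.integrable_bound[OF dom[of 1 1]])
      (use young[of 1 1] in \<open>auto intro: order_trans[OF _ abs_ge_self]\<close>)
  have le: "(LINT x|M. \<bar>g x * h x\<bar>) \<le> (Lp_seminorm M p g + e) * (Lp_seminorm M q h + e)"
    if e: "0 < e" for e
  proof -
    define a where "a = Lp_seminorm M p g + e"
    define b where "b = Lp_seminorm M q h + e"
    have ab: "0 < a" "0 < b" using e by (auto simp: a_def b_def intro: add_nonneg_pos)
    have ga: "(LINT x|M. \<bar>g x\<bar> powr p) \<le> a powr p" and hb: "(LINT x|M. \<bar>h x\<bar> powr q) \<le> b powr q"
      using Lp_seminorm_le_iff[of p a M g] Lp_seminorm_le_iff[of q b M h] p e ab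
      by (auto simp: a_def b_def)
    have "(LINT x|M. \<bar>g x * h x\<bar>) \<le>
        (LINT x|M. a * b * (\<bar>g x\<bar> powr p / a powr p / p + \<bar>h x\<bar> powr q / b powr q / q))"
      using int dom young[OF ab] by (intro integral_mono) auto
    also have "\<dots> = a * b * ((LINT x|M. \<bar>g x\<bar> powr p) / a powr p / p +
        (LINT x|M. \<bar>h x\<bar> powr q) / b powr q / q)"
      using Lp_funD(2)[OF g] Lp_funD(2)[OF h] by simp
    also have "\<dots> \<le> a * b * (1 / p + 1 / q)"
      using ga hb ab p by (intro mult_left_mono add_mono divide_right_mono) (auto simp: field_simps)
    finally show ?thesis using p by (simp add: a_def b_def)
  qed
  have "((\<lambda>e. (Lp_seminorm M p g + e) * (Lp_seminorm M q h + e)) \<longlongrightarrow>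
      (Lp_seminorm M p g + 0) * (Lp_seminorm M q h + 0)) (at_right 0)"
    by (intro tendsto_intros)
  then have "(LINT x|M. \<bar>g x * h x\<bar>) \<le> (Lp_seminorm M p g + 0) * (Lp_seminorm M q h + 0)"
    by (rule tendsto_lowerbound) (auto simp: eventually_at_right_less le intro!: eventually_at_rightI[of 0 1])
  then show "(LINT x|M. \<bar>g x * h x\<bar>) \<le> Lp_seminorm M p g * Lp_seminorm M q h" by simp
qed

section \<open>Densities of signed set functions\<close>

definition positive_variation :: "'a measure \<Rightarrow> ('a set \<Rightarrow> real) \<Rightarrow> 'a measure"
  where "positive_variation M \<phi> =
    measure_of (space M) (sets M) (\<lambda>E. SUP A\<in>{A \<in> sets M. A \<subseteq> E}. ennreal (\<phi> A))"

lemma additive_set_function_empty: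
  fixes \<phi> :: "'a set \<Rightarrow> real"
  assumes "\<And>A. range A \<subseteq> sets M \<Longrightarrow> disjoint_family A \<Longrightarrow> (\<lambda>i. \<phi> (A i)) sums \<phi> (\<Union>i::nat. A i)"
  shows "\<phi> {} = 0"
  using assms[of "\<lambda>_. {}"] by (auto simp: disjoint_family_on_def summable_const_iff dest!: sums_summable)

lemma additive_set_function_Un:
  fixes \<phi> :: "'a set \<Rightarrow> real"
  assumes add: "\<And>A. range A \<subseteq> sets M \<Longrightarrow> disjoint_family A \<Longrightarrow> (\<lambda>i. \<phi> (A i)) sums \<phi> (\<Union>i::nat. A i)"
    and AB: "A \<in> sets M" "B \<in> sets M" "A \<inter> B = {}"
  shows "\<phi> (A \<union> B) = \<phi> A + \<phi> B"
proof -
  have "(\<lambda>i. \<phi> (binaryset A B i)) sums \<phi> (\<Union>i. binaryset A B i)"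
    using AB by (intro add) (auto simp: range_binaryset_eq disjoint_family_on_def binaryset_def)
  moreover have "(\<lambda>i. \<phi> (binaryset A B i)) sums (\<phi> A + \<phi> B)"
    by (rule binaryset_sums) (rule additive_set_function_empty[OF add])
  ultimately show ?thesis by (simp add: UN_binaryset_eq sums_unique2)
qed

text \<open>
  Superadditivity holds since subsets of disjoint sets have a disjoint union, with negative values
  replaced by the value at the empty set. Conversely, a subset of a disjoint union is cut into
  its pieces, over which the set function sums up.
\<close>

lemma emeasure_positive_variation:
  fixes \<phi> :: "'a set \<Rightarrow> real"
  assumes add: "\<And>A. range A \<subseteq> sets M \<Longrightarrow> disjoint_family A \<Longrightarrow> (\<lambda>i. \<phi> (A i)) sums \<phi> (\<Union>i::nat. A i)"
    and E: "E \<in> sets M"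
  shows "emeasure (positive_variation M \<phi>) E = (SUP A\<in>{A \<in> sets M. A \<subseteq> E}. ennreal (\<phi> A))"
  unfolding positive_variation_def
proof (rule emeasure_measure_of)
  let ?\<mu> = "\<lambda>E. SUP A\<in>{A \<in> sets M. A \<subseteq> E}. ennreal (\<phi> A)"
  have empty: "\<phi> {} = 0" by (rule additive_set_function_empty[OF add])
  have sub_ne: "{A \<in> sets M. A \<subseteq> E} \<noteq> {}" for E by auto
  have upper: "ennreal (\<phi> A) \<le> ?\<mu> E" if "A \<in> sets M" "A \<subseteq> E" for A E
    using that by (intro SUP_upper) auto
  show "sets M \<subseteq> Pow (space M)" by (rule sets.space_closed)
  show "positive (sets (measure_of (space M) (sets M) ?\<mu>)) ?\<mu>"
    by (auto simp: positive_def empty)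
  show "E \<in> sets (measure_of (space M) (sets M) ?\<mu>)" using E by simp
  have superadd: "?\<mu> A + ?\<mu> B \<le> ?\<mu> (A \<union> B)" if AB: "A \<inter> B = {}" for A B
  proof -
    have pair: "ennreal (\<phi> A') + ennreal (\<phi> B') \<le> ?\<mu> (A \<union> B)"
      if A': "A' \<in> sets M" "A' \<subseteq> A" and B': "B' \<in> sets M" "B' \<subseteq> B" for A' B'
    proof -
      consider "\<phi> A' \<le> 0" | "\<phi> B' \<le> 0" | "0 \<le> \<phi> A'" "0 \<le> \<phi> B'" by linarith
      then show ?thesis
      proof cases
        case 1
        then show ?thesis using upper[of B' "A \<union> B"] B' by (auto simp: ennreal_neg)
      next
        case 2
        then show ?thesis using upper[of A' "A \<union> B"] A' by (auto simp: ennreal_neg)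
      next
        case 3
        have "\<phi> (A' \<union> B') = \<phi> A' + \<phi> B'"
          using A' B' AB by (intro additive_set_function_Un[OF add]) auto
        then show ?thesis
          using 3 upper[of "A' \<union> B'" "A \<union> B"] A' B' by (auto simp flip: ennreal_plus)
      qed
    qed
    have inner: "\<phi>' + ?\<mu> B \<le> ?\<mu> (A \<union> B)" if "\<phi>' \<in> (\<lambda>A. ennreal (\<phi> A)) ` {A' \<in> sets M. A' \<subseteq> A}" for \<phi>'
    proof -
      have "\<phi>' + ?\<mu> B = (SUP B'\<in>{B' \<in> sets M. B' \<subseteq> B}. ennreal (\<phi> B') + \<phi>')"
        using ennreal_SUP_add_left[OF sub_ne[of B], of "\<lambda>A. ennreal (\<phi> A)" \<phi>'] by (simp add: add.commute)
      also have "\<dots> \<le> ?\<mu> (A \<union> B)"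
        using that by (intro SUP_least) (auto simp: add.commute intro: pair)
      finally show ?thesis .
    qed
    have "?\<mu> A + ?\<mu> B = (SUP A'\<in>{A' \<in> sets M. A' \<subseteq> A}. ennreal (\<phi> A') + ?\<mu> B)"
      by (rule ennreal_SUP_add_left[OF sub_ne, symmetric])
    also have "\<dots> \<le> ?\<mu> (A \<union> B)" by (intro SUP_least inner) auto
    finally show ?thesis .
  qed
  have finite_superadd: "(\<Sum>i<n. ?\<mu> (A i)) \<le> ?\<mu> (\<Union>i<n. A i)" if "disjoint_family A" for A :: "nat \<Rightarrow> _" and n
  proof (induction n)
    case (Suc n)
    have "A i \<inter> A n = {}" if "i < n" for i
      using disjoint_family_onD[OF \<open>disjoint_family A\<close>, of i n] that by simp
    then have "(\<Union>i<n. A i) \<inter> A n = {}" by blast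
    then have "?\<mu> (\<Union>i<n. A i) + ?\<mu> (A n) \<le> ?\<mu> ((\<Union>i<n. A i) \<union> A n)" by (rule superadd)
    moreover have "(\<Union>i<Suc n. A i) = (\<Union>i<n. A i) \<union> A n" by (auto simp: lessThan_Suc)
    moreover have "(\<Sum>i<Suc n. ?\<mu> (A i)) = (\<Sum>i<n. ?\<mu> (A i)) + ?\<mu> (A n)" by (rule sum.lessThan_Suc)
    ultimately show ?case
      using add_right_mono[OF Suc, of "?\<mu> (A n)"] by (simp only:)
  qed simp
  have mono: "?\<mu> A \<le> ?\<mu> B" if "A \<subseteq> B" for A B
    using that by (intro SUP_subset_mono) auto
  show "countably_additive (sets (measure_of (space M) (sets M) ?\<mu>)) ?\<mu>"
  proof (rule countably_additiveI)
    fix A :: "nat \<Rightarrow> 'a set"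
    assume "range A \<subseteq> sets (measure_of (space M) (sets M) ?\<mu>)" and disj: "disjoint_family A"
    then have A: "A i \<in> sets M" for i by auto
    show "(\<Sum>i. ?\<mu> (A i)) = ?\<mu> (\<Union>i. A i)"
    proof (rule antisym)
      show "(\<Sum>i. ?\<mu> (A i)) \<le> ?\<mu> (\<Union>i. A i)"
        by (intro suminf_le_const summableI order_trans[OF finite_superadd[OF disj] mono]) auto
      show "?\<mu> (\<Union>i. A i) \<le> (\<Sum>i. ?\<mu> (A i))"
      proof (intro SUP_least)
        fix B assume "B \<in> {B \<in> sets M. B \<subseteq> (\<Union>i. A i)}"
        then have B: "B \<in> sets M" "B = (\<Union>i. A i \<inter> B)" by auto
        have "(\<lambda>i. \<phi> (A i \<inter> B)) sums \<phi> (\<Union>i. A i \<inter> B)"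
          using A B(1) by (intro add disjoint_family_subset[OF disj]) auto
        then have "(\<lambda>n. \<Sum>i<n. \<phi> (A i \<inter> B)) \<longlonglongrightarrow> \<phi> B"
          using B(2) by (simp add: sums_def)
        then have "(\<lambda>n. ennreal (\<Sum>i<n. \<phi> (A i \<inter> B))) \<longlonglongrightarrow> ennreal (\<phi> B)"
          by (rule tendsto_ennrealI)
        moreover have "ennreal (\<Sum>i<n. \<phi> (A i \<inter> B)) \<le> (\<Sum>i. ?\<mu> (A i))" for n
        proof -
          have "ennreal (\<Sum>i<n. \<phi> (A i \<inter> B)) \<le> ennreal (\<Sum>i<n. max 0 (\<phi> (A i \<inter> B)))"
            by (intro ennreal_leI sum_mono) auto
          also have "\<dots> = (\<Sum>i<n. ennreal (max 0 (\<phi> (A i \<inter> B))))" by (rule sum_ennreal[symmetric]) auto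
          also have "\<dots> = (\<Sum>i<n. ennreal (\<phi> (A i \<inter> B)))"
            by (intro sum.cong refl) (auto simp: max_def ennreal_neg)
          also have "\<dots> \<le> (\<Sum>i<n. ?\<mu> (A i))"
            using A B by (intro sum_mono upper) auto
          also have "\<dots> \<le> (\<Sum>i. ?\<mu> (A i))" by (rule sum_le_suminf) auto
          finally show ?thesis .
        qed
        ultimately show "ennreal (\<phi> B) \<le> (\<Sum>i. ?\<mu> (A i))"
          by (intro LIMSEQ_le_const2) auto
      qed
    qed
  qed
qed (rule refl)

text \<open>
  A finite measure has a real-valued density.
\<close>

lemma (in sigma_finite_measure) Radon_Nikodym_integrable:
  assumes N: "finite_measure N" "sets N = sets M" and ac: "absolutely_continuous M N"
  obtains u where "integrable M u" "\<And>E. E \<in> sets M \<Longrightarrow> measure N E = (LINT x:E|M. u x)"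
proof -
  interpret N: finite_measure N by (rule N(1))
  obtain f where f [measurable]: "f \<in> borel_measurable M" and fN: "density M f = N"
    using Radon_Nikodym[OF ac N(2)] by blast
  define u where "u x = enn2real (f x)" for x
  have u [measurable]: "u \<in> borel_measurable M" unfolding u_def by measurable
  have em: "emeasure N E = (\<integral>\<^sup>+x\<in>E. f x \<partial>M)" if "E \<in> sets M" for E
    using that unfolding fN[symmetric] by (simp add: emeasure_density)
  have "(\<integral>\<^sup>+x. f x \<partial>M) = emeasure N (space M)"
    using em[of "space M"] by (simp cong: nn_integral_cong)
  also have "\<dots> < \<infinity>" by (simp add: less_top[symmetric])
  finally have f_fin: "(\<integral>\<^sup>+x. f x \<partial>M) < \<infinity>" .
  then have fin: "AE x in M. f x = ennreal (u x)"
    using nn_integral_PInf_AE[OF f] unfolding u_def by (auto simp: less_top)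
  have "(\<integral>\<^sup>+x. ennreal (norm (u x)) \<partial>M) = (\<integral>\<^sup>+x. f x \<partial>M)"
    using fin by (intro nn_integral_cong_AE) (auto simp: u_def)
  with f_fin have int: "integrable M u" by (intro integrableI_bounded u) auto
  show thesis
  proof (rule that[OF int])
    fix E assume E [measurable]: "E \<in> sets M"
    have "ennreal (LINT x:E|M. u x) = (\<integral>\<^sup>+x. ennreal (indicator E x * u x) \<partial>M)"
      unfolding set_lebesgue_integral_def using int
      by (subst nn_integral_eq_integral)
        (auto simp: u_def intro!: integrable_real_mult_indicator integrable_mult_indicator[of E M u, simplified])
    also have "\<dots> = (\<integral>\<^sup>+x\<in>E. f x \<partial>M)"
      using fin by (intro nn_integral_cong_AE) (auto split: split_indicator)
    also have "\<dots> = emeasure N E" using em[OF E] by simp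
    finally have "ennreal (LINT x:E|M. u x) = ennreal (measure N E)"
      by (simp add: N.emeasure_eq_measure)
    moreover have "0 \<le> (LINT x:E|M. u x)"
      unfolding set_lebesgue_integral_def by (intro integral_nonneg_AE) (auto simp: u_def)
    ultimately show "measure N E = (LINT x:E|M. u x)" by simp
  qed
qed

text \<open>
  The set function is the difference of its positive variation and the positive variation of its
  negative. Indeed \<open>\<phi> A = \<phi> E - \<phi> (E - A)\<close> for \<open>A \<subseteq> E\<close>, so taking suprema shows that the two
  variations of \<open>E\<close> differ by \<open>\<phi> E\<close>. Both are finite measures that have densities.
\<close>

theorem (in sigma_finite_measure) Radon_Nikodym_signed:
  fixes \<phi> :: "'a set \<Rightarrow> real"
  assumes add: "\<And>A. range A \<subseteq> sets M \<Longrightarrow> disjoint_family A \<Longrightarrow> (\<lambda>i. \<phi> (A i)) sums \<phi> (\<Union>i::nat. A i)"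
    and bounded: "\<And>A. A \<in> sets M \<Longrightarrow> \<bar>\<phi> A\<bar> \<le> B"
    and null: "\<And>A. A \<in> null_sets M \<Longrightarrow> \<phi> A = 0"
  obtains r where "integrable M r" "\<And>E. E \<in> sets M \<Longrightarrow> \<phi> E = (LINT x:E|M. r x)"
proof -
  define P where "P = positive_variation M \<phi>"
  define Q where "Q = positive_variation M (\<lambda>A. - \<phi> A)"
  have addm: "(\<lambda>i. - \<phi> (A i)) sums - \<phi> (\<Union>i. A i)" if "range A \<subseteq> sets M" "disjoint_family A" for A
    using add[OF that] by (rule sums_minus)
  have var: "finite_measure (positive_variation M \<psi>) \<and> sets (positive_variation M \<psi>) = sets M \<and>
      absolutely_continuous M (positive_variation M \<psi>)"
    if \<psi>: "\<And>A. range A \<subseteq> sets M \<Longrightarrow> disjoint_family A \<Longrightarrow> (\<lambda>i. \<psi> (A i)) sums \<psi> (\<Union>i::nat. A i)"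
      and bd: "\<And>A. A \<in> sets M \<Longrightarrow> \<psi> A \<le> B" and n0: "\<And>A. A \<in> null_sets M \<Longrightarrow> \<psi> A = 0" for \<psi>
  proof (intro conjI)
    have spc: "space (positive_variation M \<psi>) = space M" and st: "sets (positive_variation M \<psi>) = sets M"
      by (auto simp: positive_variation_def sets.space_closed space_measure_of sets.sets_measure_of_eq)
    show "sets (positive_variation M \<psi>) = sets M" by (rule st)
    have "(SUP A\<in>{A \<in> sets M. A \<subseteq> space M}. ennreal (\<psi> A)) \<le> ennreal B"
      by (intro SUP_least ennreal_leI) (auto intro: bd)
    also have "\<dots> < \<infinity>" by simp
    finally show "finite_measure (positive_variation M \<psi>)"
      by (intro finite_measureI) (simp add: spc emeasure_positive_variation[OF \<psi>] less_top[symmetric])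
    show "absolutely_continuous M (positive_variation M \<psi>)"
      unfolding absolutely_continuous_def
    proof
      fix E assume E: "E \<in> null_sets M"
      have "\<psi> A = 0" if "A \<in> sets M" "A \<subseteq> E" for A
        using n0 null_sets_subset[OF E that] by simp
      then have "(SUP A\<in>{A \<in> sets M. A \<subseteq> E}. ennreal (\<psi> A)) \<le> 0"
        by (intro SUP_least) auto
      with E show "E \<in> null_sets (positive_variation M \<psi>)"
        by (auto simp: null_sets_def st emeasure_positive_variation[OF \<psi>])
    qed
  qed
  have Pv: "finite_measure P" "sets P = sets M" "absolutely_continuous M P"
    using var[of \<phi>] add bounded null unfolding P_def by (auto simp: abs_le_iff)
  have Qv: "finite_measure Q" "sets Q = sets M" "absolutely_continuous M Q"
    using var[of "\<lambda>A. - \<phi> A"] addm bounded null unfolding Q_def by (auto simp: abs_le_iff)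
  interpret P: finite_measure P by (rule Pv)
  interpret Q: finite_measure Q by (rule Qv)
  have shift: "measure P E \<le> measure Q E + \<phi> E" and shift': "measure Q E \<le> measure P E - \<phi> E"
    if E: "E \<in> sets M" for E
  proof -
    have compl: "\<phi> (E - A) + \<phi> A = \<phi> E" if "A \<in> sets M" "A \<subseteq> E" for A
      using additive_set_function_Un[OF add, where M = M and A = "E - A" and B = A] that E
      by (simp add: Un_absorb2 Int_commute Diff_disjoint)
    have PE: "emeasure P E = (SUP A\<in>{A \<in> sets M. A \<subseteq> E}. ennreal (\<phi> A))"
      and QE: "emeasure Q E = (SUP A\<in>{A \<in> sets M. A \<subseteq> E}. ennreal (- \<phi> A))"
      unfolding P_def Q_def using emeasure_positive_variation[OF add E]
        emeasure_positive_variation[OF addm E] by auto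
    have leP: "\<phi> A \<le> measure P E" and leQ: "- \<phi> A \<le> measure Q E" if "A \<in> sets M" "A \<subseteq> E" for A
    proof -
      have "ennreal (\<phi> A) \<le> emeasure P E" "ennreal (- \<phi> A) \<le> emeasure Q E"
        unfolding PE QE using that by (auto intro!: SUP_upper)
      then show "\<phi> A \<le> measure P E" "- \<phi> A \<le> measure Q E"
        by (simp_all add: P.emeasure_eq_measure Q.emeasure_eq_measure ennreal_le_iff)
    qed
    have "emeasure P E \<le> ennreal (measure Q E + \<phi> E)"
      unfolding PE
    proof (intro SUP_least ennreal_leI)
      fix A assume "A \<in> {A \<in> sets M. A \<subseteq> E}"
      with leQ[of "E - A"] compl[of A] E show "\<phi> A \<le> measure Q E + \<phi> E" by auto
    qed
    moreover have "0 \<le> measure Q E + \<phi> E" using leQ[of E] E by simp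
    ultimately show "measure P E \<le> measure Q E + \<phi> E"
      by (simp add: P.emeasure_eq_measure ennreal_le_iff)
    have "emeasure Q E \<le> ennreal (measure P E - \<phi> E)"
      unfolding QE
    proof (intro SUP_least ennreal_leI)
      fix A assume "A \<in> {A \<in> sets M. A \<subseteq> E}"
      with leP[of "E - A"] compl[of A] E show "- \<phi> A \<le> measure P E - \<phi> E" by auto
    qed
    moreover have "0 \<le> measure P E - \<phi> E" using leP[of E] E by simp
    ultimately show "measure Q E \<le> measure P E - \<phi> E"
      by (simp add: Q.emeasure_eq_measure ennreal_le_iff)
  qed
  obtain u where u: "integrable M u" "\<And>E. E \<in> sets M \<Longrightarrow> measure P E = (LINT x:E|M. u x)"
    using Radon_Nikodym_integrable[OF Pv] by blast
  obtain v where v: "integrable M v" "\<And>E. E \<in> sets M \<Longrightarrow> measure Q E = (LINT x:E|M. v x)"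
    using Radon_Nikodym_integrable[OF Qv] by blast
  show thesis
  proof (rule that[of "\<lambda>x. u x - v x"])
    show "integrable M (\<lambda>x. u x - v x)" using u v by simp
    fix E assume E: "E \<in> sets M"
    have "set_integrable M E u" "set_integrable M E v"
      using integrable_mult_indicator[OF E u(1)] integrable_mult_indicator[OF E v(1)]
      by (simp_all add: set_integrable_def)
    then have "(LINT x:E|M. u x - v x) = (LINT x:E|M. u x) - (LINT x:E|M. v x)"
      by (rule set_integral_diff)
    with shift[OF E] shift'[OF E] u(2)[OF E] v(2)[OF E] show "\<phi> E = (LINT x:E|M. u x - v x)" by linarith
  qed
qed

section \<open>Functionals on the spaces of p-integrable functions\<close>

text \<open>
  The powers \<open>\<bar>f n - g\<bar>\<^sup>p\<close> tend to 0 with the integrable majorant \<open>(2 G)\<^sup>p\<close>, so \<open>f n\<close> converges to \<open>g\<close> in norm.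
\<close>

lemma Lp_functional_dominated_convergence:
  assumes p: "1 \<le> p" and lin: "linear_functional_on (Lp_fun M p) \<Phi>"
    and bound: "\<And>g. g \<in> Lp_fun M p \<Longrightarrow> \<bar>\<Phi> g\<bar> \<le> C * Lp_seminorm M p g"
    and G: "G \<in> Lp_fun M p" and f: "\<And>n. f n \<in> borel_measurable M" and g: "g \<in> borel_measurable M"
    and dom: "\<And>n x. x \<in> space M \<Longrightarrow> \<bar>f n x\<bar> \<le> G x"
    and lim: "\<And>x. x \<in> space M \<Longrightarrow> (\<lambda>n. f n x) \<longlonglongrightarrow> g x"
  shows "(\<lambda>n. \<Phi> (f n)) \<longlonglongrightarrow> \<Phi> g"
proof -
  note X = function_space_Lp_fun[OF p, of M]
  have dom_g: "\<bar>g x\<bar> \<le> G x" if "x \<in> space M" for x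
    using tendsto_rabs[OF lim[OF that]] dom[OF that] by (intro LIMSEQ_le_const2) auto
  have fX: "f n \<in> Lp_fun M p" for n
    using p f dom by (intro Lp_fun_dominated[OF G, of _ 1]) (auto intro!: AE_I2 order_trans[OF _ abs_ge_self])
  have gX: "g \<in> Lp_fun M p"
    using p g dom_g by (intro Lp_fun_dominated[OF G, of _ 1]) (auto intro!: AE_I2 order_trans[OF _ abs_ge_self])
  have diffX: "(\<lambda>x. f n x - g x) \<in> Lp_fun M p" for n
    by (rule function_space_diff[OF X fX gX])
  have "(\<lambda>n. LINT x|M. \<bar>f n x - g x\<bar> powr p) \<longlonglongrightarrow> (LINT x|M. 0)"
  proof (rule integral_dominated_convergence[where w = "\<lambda>x. \<bar>2 * G x\<bar> powr p"])
    show "integrable M (\<lambda>x. \<bar>2 * G x\<bar> powr p)"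
      using Lp_funD(2)[OF function_space_scale[OF X G]] .
    show "AE x in M. (\<lambda>n. \<bar>f n x - g x\<bar> powr p) \<longlonglongrightarrow> 0"
    proof (rule AE_I2)
      fix x assume x: "x \<in> space M"
      have "(\<lambda>n. \<bar>f n x - g x\<bar>) \<longlonglongrightarrow> \<bar>g x - g x\<bar>"
        by (intro tendsto_intros lim x)
      then show "(\<lambda>n. \<bar>f n x - g x\<bar> powr p) \<longlonglongrightarrow> 0"
        using tendsto_powr'[of "\<lambda>n. \<bar>f n x - g x\<bar>" 0 sequentially "\<lambda>_. p" p] p by simp
    qed
    show "AE x in M. norm (\<bar>f n x - g x\<bar> powr p) \<le> \<bar>2 * G x\<bar> powr p" for n
    proof (rule AE_I2)
      fix x assume x: "x \<in> space M"
      have "\<bar>f n x - g x\<bar> \<le> \<bar>2 * G x\<bar>" using dom[OF x, of n] dom_g[OF x] by linarith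
      then show "norm (\<bar>f n x - g x\<bar> powr p) \<le> \<bar>2 * G x\<bar> powr p"
        using p by (simp add: powr_mono2)
    qed
  qed (use f g in measurable)
  then have "(\<lambda>n. (LINT x|M. \<bar>f n x - g x\<bar> powr p) powr (1 / p)) \<longlonglongrightarrow> 0"
    using tendsto_powr'[of "\<lambda>n. LINT x|M. \<bar>f n x - g x\<bar> powr p" 0 sequentially "\<lambda>_. 1 / p" "1 / p"] p
    by (simp add: integral_nonneg_AE)
  then have "(\<lambda>n. C * Lp_seminorm M p (\<lambda>x. f n x - g x)) \<longlonglongrightarrow> 0"
    unfolding Lp_seminorm_def by (rule tendsto_mult_right_zero)
  then have "(\<lambda>n. \<Phi> (f n) - \<Phi> g) \<longlonglongrightarrow> 0"
  proof (rule Lim_null_comparison[rotated])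
    show "\<forall>\<^sub>F n in sequentially. norm (\<Phi> (f n) - \<Phi> g) \<le> C * Lp_seminorm M p (\<lambda>x. f n x - g x)"
      using bound[OF diffX] linear_functional_diff[OF X lin fX gX] by simp
  qed
  then show ?thesis by (rule LIM_zero_cancel)
qed

lemma (in sigma_finite_measure) positive_Lp_fun_exists:
  assumes "0 < p"
  obtains k where "k \<in> Lp_fun M p" "\<And>x. x \<in> space M \<Longrightarrow> 0 < k x"
proof -
  obtain h where h [measurable]: "h \<in> borel_measurable M" and fin: "integral\<^sup>N M h \<noteq> \<infinity>"
    and pos: "\<And>x. x \<in> space M \<Longrightarrow> 0 < h x \<and> h x < \<infinity>"
    using Ex_finite_integrable_function by blast
  define k where "k x = enn2real (h x) powr (1 / p)" for x
  have kp: "\<bar>k x\<bar> powr p = enn2real (h x)" for x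
    using assms by (simp add: k_def powr_powr)
  have "(\<integral>\<^sup>+x. ennreal (enn2real (h x)) \<partial>M) = integral\<^sup>N M h"
    using pos by (intro nn_integral_cong) auto
  then have "integrable M (\<lambda>x. enn2real (h x))"
    using fin by (intro integrableI_bounded) (auto simp: less_top)
  moreover have "k \<in> borel_measurable M" unfolding k_def by measurable
  ultimately have "k \<in> Lp_fun M p" by (simp add: Lp_fun_def kp)
  moreover have "0 < k x" if "x \<in> space M" for x
  proof -
    have "0 < enn2real (h x)" using pos[OF that] by (simp add: enn2real_positive_iff)
    then show ?thesis unfolding k_def by simp
  qed
  ultimately show thesis by (rule that)
qed

lemma bounded_multiple_in_Lp:
  assumes "k \<in> Lp_fun M p" "s \<in> borel_measurable M" "0 < p" "\<And>x. x \<in> space M \<Longrightarrow> \<bar>s x\<bar> \<le> B" "0 \<le> B"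
  shows "(\<lambda>x. k x * s x) \<in> Lp_fun M p"
  using assms Lp_funD(1)[OF assms(1)]
  by (intro Lp_fun_dominated[OF assms(1), of _ B])
    (auto simp: abs_mult mult.commute[of _ "\<bar>s _\<bar>"] intro!: AE_I2 mult_right_mono)

text \<open>
  Countable additivity is dominated convergence of \<open>k * 1\<^bsub>A\<^sub>0 \<union> \<dots> \<union> A\<^sub>n\<^esub>\<close>, with majorant \<open>k\<close>. The factor \<open>k\<close>
  puts the indicators of all measurable sets, also those of infinite measure, into \<open>L\<^sup>p\<close>.
\<close>

lemma (in sigma_finite_measure) Lp_functional_weighted_density:
  assumes p: "1 \<le> p" and lin: "linear_functional_on (Lp_fun M p) \<Phi>"
    and bound: "\<And>g. g \<in> Lp_fun M p \<Longrightarrow> \<bar>\<Phi> g\<bar> \<le> C * Lp_seminorm M p g"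
    and C: "0 \<le> C" and k: "k \<in> Lp_fun M p" "\<And>x. x \<in> space M \<Longrightarrow> 0 < k x"
  obtains r where "integrable M r" "\<And>E. E \<in> sets M \<Longrightarrow> \<Phi> (\<lambda>x. k x * indicator E x) = (LINT x:E|M. r x)"
proof -
  note [measurable] = Lp_funD(1)[OF k(1)]
  note X = function_space_Lp_fun[OF p, of M]
  have p0: "0 < p" using p by simp
  define \<phi> where "\<phi> E = \<Phi> (\<lambda>x. k x * indicator E x)" for E
  have kE: "(\<lambda>x. k x * indicator E x) \<in> Lp_fun M p" if "E \<in> sets M" for E
    using that p0 by (intro bounded_multiple_in_Lp[OF k(1), of _ 1]) (auto split: split_indicator)
  have add: "(\<lambda>i. \<phi> (A i)) sums \<phi> (\<Union>i. A i)" if "range A \<subseteq> sets M" and disj: "disjoint_family A"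
    for A :: "nat \<Rightarrow> 'a set"
  proof -
    have A: "A i \<in> sets M" for i using that by auto
    have ind: "indicator (\<Union>i<n. A i) x = (\<Sum>i<n. indicator (A i) x :: real)" for n x
      using disj by (intro indicator_UN_disjoint) (auto simp: disjoint_family_on_def)
    have "\<Phi> (\<lambda>x. k x * indicator (\<Union>i<n. A i) x) = (\<Sum>i<n. \<phi> (A i))" for n
    proof (induction n)
      case 0
      have "\<Phi> (\<lambda>x. 0 * k x) = 0 * \<Phi> k"
        using lin k(1) unfolding linear_functional_on_def by blast
      then show ?case by simp
    next
      case (Suc n)
      have "(\<lambda>x. k x * indicator (\<Union>i<Suc n. A i) x) =
          (\<lambda>x. k x * indicator (\<Union>i<n. A i) x + k x * indicator (A n) x)"
        unfolding ind by (simp add: algebra_simps)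
      then have "\<Phi> (\<lambda>x. k x * indicator (\<Union>i<Suc n. A i) x) =
          \<Phi> (\<lambda>x. k x * indicator (\<Union>i<n. A i) x) + \<phi> (A n)"
        using lin kE[of "\<Union>i<n. A i"] kE[OF A] A unfolding linear_functional_on_def \<phi>_def by simp
      with Suc show ?case by simp
    qed
    moreover have "(\<lambda>n. \<Phi> (\<lambda>x. k x * indicator (\<Union>i<n. A i) x)) \<longlonglongrightarrow> \<Phi> (\<lambda>x. k x * indicator (\<Union>i. A i) x)"
    proof (rule Lp_functional_dominated_convergence[OF p lin bound k(1)])
      show "(\<lambda>n. k x * indicator (\<Union>i<n. A i) x) \<longlonglongrightarrow> k x * indicator (\<Union>i. A i) x" for x
        by (intro tendsto_mult tendsto_const LIMSEQ_indicator_UN)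
    qed (use A k(2) in \<open>auto split: split_indicator simp: less_imp_le\<close>)
    ultimately show ?thesis by (simp add: sums_def \<phi>_def)
  qed
  have bd: "\<bar>\<phi> E\<bar> \<le> C * Lp_seminorm M p k" if E: "E \<in> sets M" for E
  proof -
    have "(LINT x|M. \<bar>k x * indicator E x\<bar> powr p) \<le> (LINT x|M. \<bar>k x\<bar> powr p)"
      using Lp_funD(2)[OF kE[OF E]] Lp_funD(2)[OF k(1)]
      by (intro integral_mono) (auto split: split_indicator)
    then have "Lp_seminorm M p (\<lambda>x. k x * indicator E x) \<le> Lp_seminorm M p k"
      unfolding Lp_seminorm_def using p0 by (intro powr_mono2 integral_nonneg_AE) auto
    with bound[OF kE[OF E]] C show ?thesis
      unfolding \<phi>_def by (meson mult_left_mono order_trans)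
  qed
  have null: "\<phi> E = 0" if E: "E \<in> null_sets M" for E
  proof -
    have "AE x in M. \<bar>k x * indicator E x\<bar> = \<bar>0\<bar>"
      using AE_not_in[OF E] by eventually_elim simp
    then have "Lp_seminorm M p (\<lambda>x. k x * indicator E x) = Lp_seminorm M p (\<lambda>x. 0)"
      using E by (intro Lp_seminorm_cong_AE) auto
    then show ?thesis
      using bound[OF kE[of E]] E by (simp add: \<phi>_def Lp_seminorm_def null_setsD2)
  qed
  show thesis
    using Radon_Nikodym_signed[OF add bd null] that unfolding \<phi>_def by blast
qed

text \<open>
  Both sides are linear in \<open>s\<close> and continuous along bounded pointwise limits, so the identity
  passes from indicators to bounded measurable functions.
\<close>

lemma Lp_functional_bounded_multiple:
  assumes p: "1 \<le> p" and lin: "linear_functional_on (Lp_fun M p) \<Phi>"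
    and bound: "\<And>g. g \<in> Lp_fun M p \<Longrightarrow> \<bar>\<Phi> g\<bar> \<le> C * Lp_seminorm M p g"
    and k: "k \<in> Lp_fun M p" "\<And>x. x \<in> space M \<Longrightarrow> 0 < k x"
    and r: "integrable M r" "\<And>E. E \<in> sets M \<Longrightarrow> \<Phi> (\<lambda>x. k x * indicator E x) = (LINT x:E|M. r x)"
    and s: "s \<in> borel_measurable M" "\<And>x. x \<in> space M \<Longrightarrow> \<bar>s x\<bar> \<le> B" and B: "0 \<le> B"
  shows "\<Phi> (\<lambda>x. k x * s x) = (LINT x|M. r x * s x)"
proof -
  have p0: "0 < p" using p by simp
  note [measurable] = Lp_funD(1)[OF k(1)] borel_measurable_integrable[OF r(1)] s(1)
  note addPhi = linear_functional_add[OF lin] and scalePhi = linear_functional_scale[OF lin]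
  have kX: "(\<lambda>x. k x * u x) \<in> Lp_fun M p"
    if "u \<in> borel_measurable M" "\<And>x. x \<in> space M \<Longrightarrow> \<bar>u x\<bar> \<le> K" for u K
    using bounded_multiple_in_Lp[OF k(1) that(1) p0, of "max 0 K"] that(2) by (simp add: le_max_iff_disj)
  have rI: "integrable M (\<lambda>x. r x * u x)"
    if [measurable]: "u \<in> borel_measurable M" and le: "\<And>x. x \<in> space M \<Longrightarrow> \<bar>u x\<bar> \<le> K" for u K
  proof (rule Bochner_Integration.integrable_bound)
    show "integrable M (\<lambda>x. max 0 K * r x)" using r(1) by simp
    show "AE x in M. norm (r x * u x) \<le> norm (max 0 K * r x)"
    proof (rule AE_I2)
      fix x assume "x \<in> space M"
      then have "\<bar>u x\<bar> \<le> max 0 K" using le by (simp add: le_max_iff_disj)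
      then show "norm (r x * u x) \<le> norm (max 0 K * r x)"
        by (simp add: abs_mult mult.commute mult_left_mono)
    qed
  qed measurable
  have nonneg: "\<Phi> (\<lambda>x. k x * u x) = (LINT x|M. r x * u x)"
    if "u \<in> borel_measurable M" "\<And>x. 0 \<le> u x" "\<And>x. x \<in> space M \<Longrightarrow> u x \<le> B" for u B
    using that
  proof (induction arbitrary: B rule: borel_measurable_induct_real)
    case (set A)
    then show ?case using r(2) by (simp add: set_lebesgue_integral_def mult.commute)
  next
    case (mult u c)
    show ?case
    proof (cases "c = 0")
      case True
      then show ?thesis using scalePhi[OF k(1), of 0] by simp
    next
      case False
      have le: "u x \<le> B / c" if "x \<in> space M" for x
        using mult.prems[OF that] mult.hyps False by (simp add: field_simps)
      have "\<Phi> (\<lambda>x. c * (k x * u x)) = c * \<Phi> (\<lambda>x. k x * u x)"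
        using le mult.hyps by (intro scalePhi kX[of u "B / c"]) auto
      then show ?thesis using mult.IH[OF le] by (simp add: algebra_simps)
    qed
  next
    case (add u v)
    have le: "u x \<le> B" "v x \<le> B" if "x \<in> space M" for x
      using add.prems[OF that] add.hyps(2)[of x] add.hyps(4)[of x] by auto
    have ku: "(\<lambda>x. k x * u x) \<in> Lp_fun M p" and kv: "(\<lambda>x. k x * v x) \<in> Lp_fun M p"
      using add.hyps le by (auto intro!: kX[of _ B])
    have ru: "integrable M (\<lambda>x. r x * u x)" and rv: "integrable M (\<lambda>x. r x * v x)"
      using add.hyps le by (auto intro!: rI[of _ B])
    show ?case
      using addPhi[OF kv ku] add.IH(1)[OF le(1)] add.IH(2)[OF le(2)] ru rv
      by (simp add: distrib_left)
  next
    case (seq U)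
    have U_le: "U i x \<le> B" if x: "x \<in> space M" for i x
    proof -
      have "incseq (\<lambda>i. U i x)" using seq.hyps(3) by (auto simp: incseq_def le_fun_def)
      from incseq_le[OF this seq.hyps(4)[OF x], of i] seq.prems[OF x] show ?thesis by simp
    qed
    have B0: "0 \<le> B" if "x \<in> space M" for x
      using U_le[OF that, of 0] seq.hyps(2)[of 0 x] by linarith
    have "(\<lambda>i. \<Phi> (\<lambda>x. k x * U i x)) \<longlonglongrightarrow> \<Phi> (\<lambda>x. k x * u x)"
    proof (rule Lp_functional_dominated_convergence[OF p lin bound])
      show "(\<lambda>x. B * k x) \<in> Lp_fun M p" by (rule function_space_scale[OF function_space_Lp_fun[OF p] k(1)])
      show "\<bar>k x * U i x\<bar> \<le> B * k x" if "x \<in> space M" for i x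
        using U_le[OF that] seq.hyps(2) k(2)[OF that] by (simp add: abs_mult mult.commute mult_right_mono)
      show "(\<lambda>i. k x * U i x) \<longlonglongrightarrow> k x * u x" if "x \<in> space M" for x
        using seq.hyps(4)[OF that] by (intro tendsto_intros)
    qed (use seq.hyps that in auto)
    moreover have "(\<lambda>i. LINT x|M. r x * U i x) \<longlonglongrightarrow> (LINT x|M. r x * u x)"
    proof (rule integral_dominated_convergence)
      show "integrable M (\<lambda>x. B * \<bar>r x\<bar>)" using r(1) by simp
      show "AE x in M. (\<lambda>i. r x * U i x) \<longlonglongrightarrow> r x * u x"
        using seq.hyps(4) by (intro AE_I2 tendsto_intros)
      show "AE x in M. norm (r x * U i x) \<le> B * \<bar>r x\<bar>" for i
        using U_le seq.hyps(2) by (intro AE_I2) (simp add: abs_mult mult.commute[of B] mult_left_mono)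
    qed (use seq.hyps \<open>u \<in> borel_measurable M\<close> in auto)
    moreover have "\<Phi> (\<lambda>x. k x * U i x) = (LINT x|M. r x * U i x)" for i
      using U_le by (rule seq.IH)
    ultimately show ?case by (simp add: LIMSEQ_unique)
  qed
  define sp where "sp x = max 0 (s x)" for x
  define sm where "sm x = max 0 (- s x)" for x
  have s_eq: "s x = sp x + -1 * sm x" for x by (simp add: sp_def sm_def)
  have [measurable]: "sp \<in> borel_measurable M" "sm \<in> borel_measurable M"
    unfolding sp_def sm_def by measurable
  have le: "sp x \<le> B" "sm x \<le> B" "\<bar>sp x\<bar> \<le> B" "\<bar>sm x\<bar> \<le> B" if "x \<in> space M" for x
    using s(2)[OF that] B by (auto simp: sp_def sm_def)
  have "\<Phi> (\<lambda>x. k x * sp x + -1 * (k x * sm x)) = \<Phi> (\<lambda>x. k x * sp x) + \<Phi> (\<lambda>x. -1 * (k x * sm x))"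
    using le by (intro addPhi kX[of _ B] function_space_scale[OF function_space_Lp_fun[OF p]]) auto
  also have "\<Phi> (\<lambda>x. -1 * (k x * sm x)) = -1 * \<Phi> (\<lambda>x. k x * sm x)"
    using le by (intro scalePhi kX[of _ B]) auto
  also have "\<Phi> (\<lambda>x. k x * sm x) = (LINT x|M. r x * sm x)"
    using le by (intro nonneg[of _ B]) (auto simp: sm_def)
  also have "\<Phi> (\<lambda>x. k x * sp x) = (LINT x|M. r x * sp x)"
    using le by (intro nonneg[of _ B]) (auto simp: sp_def)
  also have "(LINT x|M. r x * sp x) + -1 * (LINT x|M. r x * sm x) = (LINT x|M. r x * sp x + -1 * (r x * sm x))"
    using rI[of sp B] rI[of sm B] le by simp
  finally show ?thesis unfolding s_eq by (simp add: algebra_simps)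
qed

theorem (in sigma_finite_measure) Riesz_representation_Lp:
  assumes p: "1 < p" and q: "1 / p + 1 / q = 1"
    and lin: "linear_functional_on (Lp_fun M p) \<Phi>"
    and bound: "\<And>g. g \<in> Lp_fun M p \<Longrightarrow> \<Phi> g \<le> C * Lp_seminorm M p g" and C: "0 \<le> C"
  obtains h where "h \<in> Lp_fun M q" "Lp_seminorm M q h \<le> C"
    "\<And>g. g \<in> Lp_fun M p \<Longrightarrow> \<Phi> g = (LINT x|M. g x * h x)"
proof -
  have p1: "1 \<le> p" "0 < p" using p by auto
  note X = function_space_Lp_fun[OF p1(1), of M]
  have q_eq: "q = p / (p - 1)"
  proof -
    have "1 / q = (p - 1) / p" using q p by (simp add: field_simps)
    then show ?thesis by (metis inverse_divide inverse_eq_divide inverse_inverse_eq)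
  qed
  have q1: "1 < q" and conj: "(q - 1) * p = q" "1 - 1 / p = 1 / q"
    using p q unfolding q_eq by (auto simp: field_simps)
  have bound': "\<bar>\<Phi> g\<bar> \<le> C * Lp_seminorm M p g" if g: "g \<in> Lp_fun M p" for g
  proof -
    show ?thesis
      using linear_functional_scale[OF lin g, of "-1"] bound[OF g] bound[OF function_space_scale[OF X g, of "-1"]] Lp_seminorm_scale[OF p1(2), of M "-1" g]
      by simp
  qed
  obtain k where k: "k \<in> Lp_fun M p" "\<And>x. x \<in> space M \<Longrightarrow> 0 < k x"
    using positive_Lp_fun_exists[OF p1(2)] by blast
  obtain r where r: "integrable M r" "\<And>E. E \<in> sets M \<Longrightarrow> \<Phi> (\<lambda>x. k x * indicator E x) = (LINT x:E|M. r x)"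
    using Lp_functional_weighted_density[OF p1(1) lin bound' C k] by blast
  note [measurable] = Lp_funD(1)[OF k(1)] borel_measurable_integrable[OF r(1)]
  define h where "h x = r x / k x" for x
  have [measurable]: "h \<in> borel_measurable M" unfolding h_def by measurable
  have rep: "\<Phi> g = (LINT x|M. g x * h x)"
    if g: "g \<in> borel_measurable M" and le: "\<And>x. x \<in> space M \<Longrightarrow> \<bar>g x\<bar> \<le> B * k x" and B: "0 \<le> B" for g B
  proof -
    have "\<bar>g x / k x\<bar> \<le> B" if "x \<in> space M" for x
      using le[OF that] k(2)[OF that] by (simp add: field_simps)
    then have "\<Phi> (\<lambda>x. k x * (g x / k x)) = (LINT x|M. r x * (g x / k x))"
      using B g by (intro Lp_functional_bounded_multiple[OF p1(1) lin bound' k r]) auto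
    moreover have "(LINT x|M. r x * (g x / k x)) = (LINT x|M. g x * h x)"
      by (intro Bochner_Integration.integral_cong) (auto simp: h_def)
    \<comment> \<open>The two arguments agree on the space only, where \<open>k\<close> is positive; \<open>\<Phi>\<close> does not see the rest.\<close>
    moreover have "\<Phi> (\<lambda>x. k x * (g x / k x)) = \<Phi> g"
    proof -
      have gX: "g \<in> Lp_fun M p" and eX: "(\<lambda>x. k x * (g x / k x)) \<in> Lp_fun M p"
        using le B p1 g k(2)
        by (auto intro!: Lp_fun_dominated[OF k(1), of _ B] AE_I2 simp: less_imp_neq[symmetric] abs_of_pos)
      have z: "(\<lambda>x. k x * (g x / k x) - g x) \<in> Lp_fun M p" by (rule function_space_diff[OF X eX gX])
      have "Lp_seminorm M p (\<lambda>x. k x * (g x / k x) - g x) = Lp_seminorm M p (\<lambda>x. 0)"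
        using Lp_funD(1)[OF z] by (intro Lp_seminorm_cong_AE AE_I2) (auto dest!: k(2))
      then show ?thesis
        using bound'[OF z] linear_functional_diff[OF X lin eX gX] by (simp add: Lp_seminorm_def)
    qed
    ultimately show ?thesis by simp
  qed
  define A where "A n = {x \<in> space M. \<bar>h x\<bar> powr (q - 1) \<le> real n * k x}" for n
  have A [measurable]: "A n \<in> sets M" for n unfolding A_def by measurable
  define J where "J n = (LINT x|M. \<bar>h x\<bar> powr q * indicator (A n) x)" for n
  have J: "integrable M (\<lambda>x. \<bar>h x\<bar> powr q * indicator (A n) x) \<and> J n \<le> C powr q" for n
  proof
    \<comment> \<open>The extremal test function for \<open>h\<close>: \<open>g * h = \<bar>g\<bar>\<^sup>p = \<bar>h\<bar>\<^sup>q\<close>. On \<open>A n\<close> it is dominated by \<open>n * k\<close>.\<close>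
    define g where "g x = sgn (h x) * \<bar>h x\<bar> powr (q - 1) * indicator (A n) x" for x
    have [measurable]: "g \<in> borel_measurable M" unfolding g_def by measurable
    have g_le: "\<bar>g x\<bar> \<le> real n * k x" if "x \<in> space M" for x
      using k(2)[OF that] by (auto simp: g_def A_def abs_mult sgn_if split: split_indicator)
    have gX: "g \<in> Lp_fun M p"
      using g_le p1 k(2)
      by (intro Lp_fun_dominated[OF k(1), of _ "real n"]) (auto intro!: AE_I2 simp: abs_of_pos)
    have gp: "\<bar>g x\<bar> powr p = \<bar>h x\<bar> powr q * indicator (A n) x" for x
      using conj(1) p1 q1 by (auto simp: g_def abs_mult abs_sgn_eq powr_powr split: split_indicator)
    have gh: "g x * h x = \<bar>h x\<bar> powr q * indicator (A n) x" for x
    proof -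
      have "sgn (h x) * \<bar>h x\<bar> powr (q - 1) * h x = \<bar>h x\<bar> powr (q - 1) * \<bar>h x\<bar> powr 1"
        by (simp add: sgn_if)
      also have "\<dots> = \<bar>h x\<bar> powr q" by (subst powr_add[symmetric]) simp
      finally show ?thesis by (simp add: g_def mult_ac)
    qed
    show int: "integrable M (\<lambda>x. \<bar>h x\<bar> powr q * indicator (A n) x)"
      using Lp_funD(2)[OF gX] unfolding gp .
    have J0: "0 \<le> J n" unfolding J_def by (intro integral_nonneg_AE) auto
    have "J n = \<Phi> g"
      using rep[of g "real n"] g_le unfolding J_def gh by simp
    also have "\<dots> \<le> C * J n powr (1 / p)"
      using bound[OF gX] unfolding Lp_seminorm_def gp J_def .
    finally have le: "J n \<le> C * J n powr (1 / p)" .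
    show "J n \<le> C powr q"
    proof (cases "J n = 0")
      case False
      then have pos: "0 < J n" using J0 by simp
      have "J n powr (1 / q) * J n powr (1 / p) = J n"
        using q pos by (subst powr_add[symmetric]) (simp add: add.commute)
      with le have "J n powr (1 / q) * J n powr (1 / p) \<le> C * J n powr (1 / p)" by simp
      \<comment> \<open>Division by \<open>J n powr (1 / p)\<close> is allowed as \<open>J n\<close> is finite and positive.\<close>
      then have "J n powr (1 / q) \<le> C" using pos by simp
      then have "(J n powr (1 / q)) powr q \<le> C powr q" using q1 by (intro powr_mono2) auto
      then show ?thesis using pos q1 by (simp add: powr_powr)
    qed simp
  qed
  have nn_le: "(\<integral>\<^sup>+x. ennreal (\<bar>h x\<bar> powr q) * indicator (space M) x \<partial>M) \<le> ennreal (C powr q)"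
  proof (rule LIMSEQ_le_const2)
    show "(\<lambda>n. \<integral>\<^sup>+x. ennreal (\<bar>h x\<bar> powr q * indicator (A n) x) \<partial>M) \<longlonglongrightarrow>
        (\<integral>\<^sup>+x. ennreal (\<bar>h x\<bar> powr q) * indicator (space M) x \<partial>M)"
    proof (rule nn_integral_LIMSEQ)
      have "A m \<subseteq> A n" if "m \<le> n" for m n
        unfolding A_def using that k(2) by (auto intro: order_trans mult_right_mono less_imp_le)
      then show "incseq (\<lambda>n x. ennreal (\<bar>h x\<bar> powr q * indicator (A n) x))"
        by (auto simp: incseq_def le_fun_def intro!: ennreal_leI mult_left_mono split: split_indicator)
      fix x
      show "(\<lambda>n. ennreal (\<bar>h x\<bar> powr q * indicator (A n) x)) \<longlonglongrightarrow> ennreal (\<bar>h x\<bar> powr q) * indicator (space M) x"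
      proof (cases "x \<in> space M")
        case True
        obtain N where N: "\<bar>h x\<bar> powr (q - 1) / k x \<le> real N" using real_arch_simple by blast
        have "x \<in> A n" if "N \<le> n" for n
        proof -
          have "\<bar>h x\<bar> powr (q - 1) / k x \<le> real n" using N that by linarith
          then show ?thesis using True k(2)[OF True] by (simp add: A_def field_simps)
        qed
        then have "\<forall>\<^sub>F n in sequentially.
            ennreal (\<bar>h x\<bar> powr q * indicator (A n) x) = ennreal (\<bar>h x\<bar> powr q) * indicator (space M) x"
          using True by (auto simp: eventually_sequentially intro!: exI[of _ N])
        then show ?thesis by (rule tendsto_eventually)
      qed (simp add: A_def)
    qed measurable
    show "\<exists>N. \<forall>n\<ge>N. (\<integral>\<^sup>+x. ennreal (\<bar>h x\<bar> powr q * indicator (A n) x) \<partial>M) \<le> ennreal (C powr q)"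
      using J by (intro exI[of _ 0]) (auto simp: nn_integral_eq_integral J_def intro!: ennreal_leI)
  qed
  then have nn_le': "(\<integral>\<^sup>+x. ennreal (\<bar>h x\<bar> powr q) \<partial>M) \<le> ennreal (C powr q)"
    by (simp cong: nn_integral_cong)
  have hX: "h \<in> Lp_fun M q"
    using nn_le' unfolding Lp_fun_def
    by (auto intro!: integrableI_bounded simp: order_le_less_trans[OF _ ennreal_less_top])
  show thesis
  proof (rule that[OF hX])
    have "(LINT x|M. \<bar>h x\<bar> powr q) \<le> C powr q"
      using nn_le' nn_integral_eq_integral[OF Lp_funD(2)[OF hX]] by (simp add: ennreal_le_iff)
    then show "Lp_seminorm M q h \<le> C"
      using Lp_seminorm_le_iff[of q C M h] q1 C by simp
    fix g assume g: "g \<in> Lp_fun M p"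
    note [measurable] = Lp_funD(1)[OF g]
    define B where "B n = {x \<in> space M. \<bar>g x\<bar> \<le> real n * k x}" for n
    have [measurable]: "B n \<in> sets M" for n unfolding B_def by measurable
    have B_lim: "(\<lambda>n. indicator (B n) x :: real) \<longlonglongrightarrow> 1" if x: "x \<in> space M" for x
    proof -
      obtain N where N: "\<bar>g x\<bar> / k x \<le> real N" using real_arch_simple by blast
      have "x \<in> B n" if "N \<le> n" for n
      proof -
        have "\<bar>g x\<bar> / k x \<le> real n" using N that by linarith
        then show ?thesis using x k(2)[OF x] by (simp add: B_def field_simps)
      qed
      then have "\<forall>\<^sub>F n in sequentially. indicator (B n) x = (1::real)"
        by (auto simp: eventually_sequentially intro!: exI[of _ N])
      then show ?thesis by (rule tendsto_eventually)
    qed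
    have "(\<lambda>n. \<Phi> (\<lambda>x. g x * indicator (B n) x)) \<longlonglongrightarrow> \<Phi> g"
    proof (rule Lp_functional_dominated_convergence[OF p1(1) lin bound', where G = "\<lambda>x. \<bar>g x\<bar>"])
      show "(\<lambda>x. \<bar>g x\<bar>) \<in> Lp_fun M p" using g by (simp add: Lp_fun_def)
      show "(\<lambda>n. g x * indicator (B n) x) \<longlonglongrightarrow> g x" if "x \<in> space M" for x
        using tendsto_mult[OF tendsto_const[of "g x"] B_lim[OF that]] by simp
    qed (auto split: split_indicator)
    moreover have "(\<lambda>n. LINT x|M. g x * indicator (B n) x * h x) \<longlonglongrightarrow> (LINT x|M. g x * h x)"
    proof (rule integral_dominated_convergence[where w = "\<lambda>x. \<bar>g x * h x\<bar>"])
      show "integrable M (\<lambda>x. \<bar>g x * h x\<bar>)"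
        using Hoelder_inequality(1)[OF p q1 q g hX] by simp
      show "AE x in M. (\<lambda>n. g x * indicator (B n) x * h x) \<longlonglongrightarrow> g x * h x"
        using tendsto_mult[OF tendsto_mult[OF tendsto_const B_lim] tendsto_const] by (intro AE_I2) simp
    qed (auto split: split_indicator)
    moreover have "\<Phi> (\<lambda>x. g x * indicator (B n) x) = (LINT x|M. g x * indicator (B n) x * h x)" for n
      by (rule rep[of _ "real n"]) (auto simp: B_def less_imp_le[OF k(2)] split: split_indicator)
    ultimately show "\<Phi> g = (LINT x|M. g x * h x)" by (simp add: LIMSEQ_unique)
  qed
qed

section \<open>The weighted primitive as an isometry\<close>

lemma sigma_finite_lebesgue_on:
  fixes S :: "'a::euclidean_space set"
  assumes "S \<in> sets lebesgue"
  shows "sigma_finite_measure (lebesgue_on S)"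
proof (rule sigma_finite_measure_restrict_space[OF _ assms])
  show "sigma_finite_measure (lebesgue :: 'a measure)"
  proof
    obtain A :: "'a set set" where A: "countable A" "A \<subseteq> sets lborel" "\<Union>A = space lborel"
      "\<forall>a\<in>A. emeasure lborel a \<noteq> \<infinity>"
      using lborel.sigma_finite_countable by blast
    then show "\<exists>A :: 'a set set. countable A \<and> A \<subseteq> sets lebesgue \<and> \<Union>A = space lebesgue \<and>
        (\<forall>a\<in>A. emeasure lebesgue a \<noteq> \<infinity>)"
      by (intro exI[of _ A]) (auto simp: subset_eq)
  qed
qed

lemma borel_measurable_e2ennreal [measurable (raw)]:
  "f \<in> borel_measurable M \<Longrightarrow> (\<lambda>x. e2ennreal (f x)) \<in> borel_measurable M"
  using measurable_compose[OF _ measurable_e2ennreal] .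

lemma e2ennreal_abs_finite: "\<bar>y\<bar> \<noteq> \<infinity> \<Longrightarrow> e2ennreal \<bar>y\<bar> = ennreal \<bar>real_of_ereal y\<bar>"
  by (cases y) auto

text \<open>
  This reduces extended-real valued integrands to real ones: an integrable function is finite
  almost everywhere, and there \<open>real_of_ereal\<close> is additive.
\<close>

lemma eintegrable_on_iff:
  "eintegrable_on f S \<longleftrightarrow> f \<in> borel_measurable (lebesgue_on S) \<and>
    (AE x in lebesgue_on S. \<bar>f x\<bar> \<noteq> \<infinity>) \<and> integrable (lebesgue_on S) (\<lambda>x. real_of_ereal (f x))"
proof (cases "f \<in> borel_measurable (lebesgue_on S)")
  case True
  note [measurable] = True
  let ?M = "lebesgue_on S"
  have fin_iff: "nn_int S (\<lambda>x. \<bar>f x\<bar>) < \<infinity> \<longleftrightarrow> (\<integral>\<^sup>+x. e2ennreal \<bar>f x\<bar> \<partial>?M) < \<infinity>"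
    unfolding nn_int_def by (cases "\<integral>\<^sup>+x. e2ennreal \<bar>f x\<bar> \<partial>?M" rule: ennreal_cases) auto
  have eq: "(\<integral>\<^sup>+x. e2ennreal \<bar>f x\<bar> \<partial>?M) = (\<integral>\<^sup>+x. ennreal (norm (real_of_ereal (f x))) \<partial>?M)"
    if "AE x in ?M. \<bar>f x\<bar> \<noteq> \<infinity>"
    using that by (intro nn_integral_cong_AE) (auto simp: e2ennreal_abs_finite)
  have "AE x in ?M. \<bar>f x\<bar> \<noteq> \<infinity>" if "(\<integral>\<^sup>+x. e2ennreal \<bar>f x\<bar> \<partial>?M) < \<infinity>"
  proof -
    have "AE x in ?M. e2ennreal \<bar>f x\<bar> \<noteq> \<infinity>"
      using that by (intro nn_integral_PInf_AE) auto
    then show ?thesis by eventually_elim auto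
  qed
  with True eq show ?thesis
    unfolding eintegrable_on_def fin_iff by (auto simp: integrable_iff_bounded)
qed (simp add: eintegrable_on_def)

lemma eintegrable_on_add:
  assumes "eintegrable_on f S" "eintegrable_on g S"
  shows "eintegrable_on (\<lambda>x. f x + g x) S"
    and "eint S (\<lambda>x. f x + g x) = eint S f + eint S g"
proof -
  note f = assms(1)[unfolded eintegrable_on_iff] and g = assms(2)[unfolded eintegrable_on_iff]
  have [measurable]: "f \<in> borel_measurable (lebesgue_on S)" "g \<in> borel_measurable (lebesgue_on S)"
    using f g by auto
  have fin: "AE x in lebesgue_on S. \<bar>f x\<bar> \<noteq> \<infinity> \<and> \<bar>g x\<bar> \<noteq> \<infinity>" using f g by auto
  have eq: "AE x in lebesgue_on S. real_of_ereal (f x + g x) = real_of_ereal (f x) + real_of_ereal (g x)"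
    using fin by eventually_elim (auto simp: real_of_ereal_add)
  have "integrable (lebesgue_on S) (\<lambda>x. real_of_ereal (f x + g x)) \<longleftrightarrow>
      integrable (lebesgue_on S) (\<lambda>x. real_of_ereal (f x) + real_of_ereal (g x))"
    using eq by (intro integrable_cong_AE) auto
  moreover have "AE x in lebesgue_on S. \<bar>f x + g x\<bar> \<noteq> \<infinity>"
    using fin by eventually_elim auto
  ultimately show "eintegrable_on (\<lambda>x. f x + g x) S"
    using f g unfolding eintegrable_on_iff by simp
  have "eint S (\<lambda>x. f x + g x) = (LINT x|lebesgue_on S. real_of_ereal (f x) + real_of_ereal (g x))"
    unfolding eint_def using eq by (intro integral_cong_AE) auto
  then show "eint S (\<lambda>x. f x + g x) = eint S f + eint S g"
    using f g by (simp add: eint_def)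
qed

lemma eintegrable_on_scale:
  assumes "eintegrable_on f S"
  shows "eintegrable_on (\<lambda>x. ereal a * f x) S"
    and "eint S (\<lambda>x. ereal a * f x) = a * eint S f"
proof -
  note f = assms[unfolded eintegrable_on_iff]
  have "AE x in lebesgue_on S. \<bar>ereal a * f x\<bar> \<noteq> \<infinity>"
    using conjunct1[OF conjunct2[OF f]] by eventually_elim auto
  then show "eintegrable_on (\<lambda>x. ereal a * f x) S"
    using f unfolding eintegrable_on_iff by (auto intro!: borel_measurable_ereal_times)
  show "eint S (\<lambda>x. ereal a * f x) = a * eint S f"
    by (simp add: eint_def)
qed

lemma Lp_norm_real:
  assumes p: "0 < p" and t: "t \<in> borel_measurable (lebesgue_on S)"
    and u: "AE x in lebesgue_on S. \<bar>u x\<bar> = ereal \<bar>t x\<bar>"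
  shows "Lp_norm p S u < \<infinity> \<longleftrightarrow> t \<in> Lp_fun (lebesgue_on S) p"
    and "t \<in> Lp_fun (lebesgue_on S) p \<Longrightarrow> Lp_norm p S u = ereal (Lp_seminorm (lebesgue_on S) p t)"
proof -
  let ?M = "lebesgue_on S"
  define X where "X = (\<integral>\<^sup>+x. ennreal (\<bar>t x\<bar> powr p) \<partial>?M)"
  have "AE x in ?M. e2ennreal (epow \<bar>u x\<bar> p) = ennreal (\<bar>t x\<bar> powr p)"
    using u by eventually_elim (simp add: epow_def)
  then have "nn_int S (\<lambda>x. epow \<bar>u x\<bar> p) = enn2ereal X"
    unfolding nn_int_def X_def by (simp cong: nn_integral_cong_AE)
  then have norm: "Lp_norm p S u = epow (enn2ereal X) (1 / p)"
    by (simp add: Lp_norm_def)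
  have X_fin: "X < \<infinity> \<longleftrightarrow> t \<in> Lp_fun ?M p"
    unfolding X_def Lp_fun_def using t by (auto simp: integrable_iff_bounded)
  show "Lp_norm p S u < \<infinity> \<longleftrightarrow> t \<in> Lp_fun ?M p"
    unfolding X_fin[symmetric] norm by (cases X rule: ennreal_cases) (auto simp: epow_def)
  assume tX: "t \<in> Lp_fun ?M p"
  have "X = ennreal (LINT x|?M. \<bar>t x\<bar> powr p)"
    unfolding X_def using Lp_funD(2)[OF tX] by (intro nn_integral_eq_integral) auto
  then show "Lp_norm p S u = ereal (Lp_seminorm ?M p t)"
    unfolding norm by (simp add: epow_def Lp_seminorm_def enn2ereal_ennreal integral_nonneg_AE)
qed

lemma I_sub_subset: "I_sub c d \<nu> x \<subseteq> einterval c d"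
  by (auto simp: I_sub_def)

lemma sets_I_sub [measurable]: "I_sub c d \<nu> x \<in> sets lebesgue"
  and sets_I_sub_star [measurable]: "I_sub_star c d \<nu> x \<in> sets lebesgue"
  and sets_einterval_lebesgue [measurable]: "einterval c d \<in> sets lebesgue"
  by (auto simp: I_sub_def I_sub_star_def intro!: sets_completionI_sets)

lemma L1_loc_iff:
  "f \<in> L1_loc c d \<nu> 1 \<longleftrightarrow>
    f \<in> meas_fun c d \<and> (\<forall>x\<in>einterval c d. eintegrable_on f (I_sub c d \<nu> x))"
  unfolding L1_loc_def eintegrable_on_def
  using measurable_restrict_mono[OF _ I_sub_subset] by (auto simp: meas_fun_def)

text \<open>
  The primitive is the difference of the primitives of the positive and the negative part of \<open>f\<close>,
  which are monotone in \<open>x\<close> since the domains of integration are nested.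
\<close>

lemma borel_measurable_primitive:
  assumes f: "f \<in> L1_loc c d \<nu> 1"
  shows "(\<lambda>x. eint (I_sub c d \<nu> x) f) \<in> borel_measurable (lebesgue_on (einterval c d))"
proof -
  let ?I = "einterval c d"
  define r where "r y = real_of_ereal (f y)" for y
  define G where "G s x = (LINT y|lebesgue. indicator (I_sub c d \<nu> x) y * max 0 (s * r y))" for s x
  have int_r: "integrable lebesgue (\<lambda>y. indicator (I_sub c d \<nu> x) y * r y)" if "x \<in> ?I" for x
    using f that unfolding L1_loc_iff eintegrable_on_iff r_def
    by (subst (asm) integrable_restrict_space) (auto simp: sets_I_sub)
  have int_s: "integrable lebesgue (\<lambda>y. indicator (I_sub c d \<nu> x) y * max 0 (s * r y))"
    if "x \<in> ?I" for x s
  proof -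
    have "integrable lebesgue (\<lambda>y. max 0 (s * (indicator (I_sub c d \<nu> x) y * r y)))"
      using int_r[OF that] by (intro integrable_max) auto
    moreover have "max 0 (s * (indicator (I_sub c d \<nu> x) y * r y)) =
        indicator (I_sub c d \<nu> x) y * max 0 (s * r y)" for y
      by (simp split: split_indicator)
    ultimately show ?thesis by simp
  qed
  have mono: "G s x \<le> G s y" if "x \<in> ?I" "y \<in> ?I" "I_sub c d \<nu> x \<subseteq> I_sub c d \<nu> y" for s x y
    unfolding G_def using that by (intro integral_mono int_s) (auto split: split_indicator)
  have meas: "G s \<in> borel_measurable (lebesgue_on ?I)" for s
  proof -
    have "G s \<in> borel_measurable (restrict_space borel ?I)"
    proof (cases "\<nu> = 1")
      case True
      have "mono_on ?I (G s)"
        by (intro mono_onI mono) (auto simp: I_sub_def True)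
      then show ?thesis by (rule borel_measurable_mono_on_fnc)
    next
      case False
      have "mono_on ?I (\<lambda>x. - G s x)"
        using False by (intro mono_onI le_imp_neg_le mono) (auto simp: I_sub_def)
      from borel_measurable_mono_on_fnc[OF this] show ?thesis by simp
    qed
    moreover have "(\<lambda>x. x) \<in> measurable (lebesgue_on ?I) (restrict_space borel ?I)"
      by (intro measurable_restrict_space3 measurable_completion) auto
    ultimately show ?thesis by (rule measurable_compose[rotated])
  qed
  have "eint (I_sub c d \<nu> x) f = G 1 x - G (-1) x" if x: "x \<in> ?I" for x
  proof -
    have "eint (I_sub c d \<nu> x) f = (LINT y|lebesgue. indicator (I_sub c d \<nu> x) y * r y)"
      unfolding eint_def r_def by (subst integral_restrict_space) (auto simp: sets_I_sub)
    also have "\<dots> = (LINT y|lebesgue. indicator (I_sub c d \<nu> x) y * max 0 (1 * r y) -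
        indicator (I_sub c d \<nu> x) y * max 0 (-1 * r y))"
      by (intro Bochner_Integration.integral_cong refl) (auto simp: max_def split: split_indicator)
    also have "\<dots> = G 1 x - G (-1) x"
      unfolding G_def by (intro Bochner_Integration.integral_diff int_s x)
    finally show ?thesis .
  qed
  moreover have "(\<lambda>x. G 1 x - G (-1) x) \<in> borel_measurable (lebesgue_on ?I)"
    using meas by measurable
  ultimately show ?thesis
    by (subst measurable_cong[where g = "\<lambda>x. G 1 x - G (-1) x"]) auto
qed

text \<open>
  On each of the domains of integration the weight is finite almost everywhere, and countably many
  of these domains, with rational end points, cover the open interval.
\<close>

lemma finite_AE_of_L1_loc_2:
  assumes p: "0 < p" and w: "(\<lambda>x. epow (w x) p) \<in> L1_loc c d \<nu> 2"
  shows "AE x in lebesgue_on (einterval c d). w x \<noteq> \<infinity>"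
proof -
  let ?I = "einterval c d" and ?S = "\<lambda>x. I_sub_star c d \<nu> x"
  have "AE y in lebesgue. of_rat q \<in> ?I \<longrightarrow> y \<in> ?S (of_rat q) \<longrightarrow> w y \<noteq> \<infinity>" for q
  proof (cases "of_rat q \<in> ?I")
    case True
    have sub: "?S x \<subseteq> ?I" for x by (auto simp: I_sub_star_def)
    have "eintegrable_on (\<lambda>x. epow (w x) p) (?S (of_rat q))"
      using w True measurable_restrict_mono[OF _ sub]
      unfolding L1_loc_def eintegrable_on_def by (auto simp: meas_fun_def)
    then have "AE y in lebesgue_on (?S (of_rat q)). \<bar>epow (w y) p\<bar> \<noteq> \<infinity>"
      by (simp add: eintegrable_on_iff)
    then have "AE y in lebesgue. y \<in> ?S (of_rat q) \<longrightarrow> \<bar>epow (w y) p\<bar> \<noteq> \<infinity>"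
      by (subst (asm) AE_restrict_space_iff) (auto simp: sets_I_sub_star)
    then show ?thesis by eventually_elim (auto simp: epow_def)
  qed simp
  then have "AE y in lebesgue. \<forall>q. of_rat q \<in> ?I \<longrightarrow> y \<in> ?S (of_rat q) \<longrightarrow> w y \<noteq> \<infinity>"
    by (simp add: AE_all_countable)
  then have "AE y in lebesgue. y \<in> ?I \<longrightarrow> w y \<noteq> \<infinity>"
  proof eventually_elim
    case (elim y)
    show ?case
    proof
      assume y: "y \<in> ?I"
      then obtain e where e: "0 < e" "ball y e \<subseteq> ?I"
        using open_einterval[of c d] by (auto simp: open_contains_ball)
      \<comment> \<open>Which of \<open>q\<close> and \<open>q'\<close> gives a domain that contains \<open>y\<close> depends on \<open>\<nu>\<close>.\<close>
      obtain q where q: "y - e < of_rat q" "of_rat q < y" using of_rat_dense[of "y - e" y] e by auto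
      obtain q' where q': "y < of_rat q'" "of_rat q' < y + e" using of_rat_dense[of y "y + e"] e by auto
      have "of_rat q \<in> ?I" "of_rat q' \<in> ?I"
        using e q q' by (auto simp: subset_eq dist_real_def)
      moreover have "y \<in> ?S (of_rat q) \<or> y \<in> ?S (of_rat q')"
        using y q q' by (auto simp: I_sub_star_def)
      ultimately show "w y \<noteq> \<infinity>" using elim by blast
    qed
  qed
  then show ?thesis by (subst AE_restrict_space_iff) (auto simp: sets_einterval_lebesgue)
qed

text \<open>
  The value 0 off the interval makes the map \<open>f \<mapsto> weighted_primitive c d \<nu> w f\<close> linear as a map into
  functions on the whole line; off the interval the integral need not converge.
\<close>

definition weighted_primitive ::
  "ereal \<Rightarrow> ereal \<Rightarrow> nat \<Rightarrow> (real \<Rightarrow> ereal) \<Rightarrow> (real \<Rightarrow> ereal) \<Rightarrow> real \<Rightarrow> real"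
  where "weighted_primitive c d \<nu> w f x =
    (if x \<in> einterval c d then real_of_ereal (w x) * eint (I_sub c d \<nu> x) f else 0)"

lemma L1_loc_add:
  assumes "f \<in> L1_loc c d \<nu> 1" "g \<in> L1_loc c d \<nu> 1"
  shows "(\<lambda>x. f x + g x) \<in> L1_loc c d \<nu> 1"
  using assms eintegrable_on_add(1) unfolding L1_loc_iff by (auto simp: meas_fun_def)

lemma L1_loc_scale:
  assumes "f \<in> L1_loc c d \<nu> 1"
  shows "(\<lambda>x. ereal a * f x) \<in> L1_loc c d \<nu> 1"
  using assms eintegrable_on_scale(1) unfolding L1_loc_iff
  by (auto simp: meas_fun_def intro!: borel_measurable_ereal_times)

lemma weighted_primitive_add:
  assumes "f \<in> L1_loc c d \<nu> 1" "g \<in> L1_loc c d \<nu> 1"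
  shows "weighted_primitive c d \<nu> w (\<lambda>x. f x + g x) =
    (\<lambda>x. weighted_primitive c d \<nu> w f x + weighted_primitive c d \<nu> w g x)"
  using assms eintegrable_on_add(2) unfolding L1_loc_iff
  by (auto simp: weighted_primitive_def fun_eq_iff distrib_left)

lemma weighted_primitive_scale:
  assumes "f \<in> L1_loc c d \<nu> 1"
  shows "weighted_primitive c d \<nu> w (\<lambda>x. ereal a * f x) = (\<lambda>x. a * weighted_primitive c d \<nu> w f x)"
  using assms eintegrable_on_scale(2) unfolding L1_loc_iff
  by (auto simp: weighted_primitive_def fun_eq_iff)

lemma borel_measurable_weighted_primitive:
  assumes "f \<in> L1_loc c d \<nu> 1" "w \<in> meas_fun c d"
  shows "weighted_primitive c d \<nu> w f \<in> borel_measurable (lebesgue_on (einterval c d))"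
proof -
  have "(\<lambda>x. real_of_ereal (w x) * eint (I_sub c d \<nu> x) f) \<in> borel_measurable (lebesgue_on (einterval c d))"
    using borel_measurable_primitive[OF assms(1)] assms(2) by (auto simp: meas_fun_def)
  then show ?thesis
    by (subst measurable_cong[where g = "\<lambda>x. real_of_ereal (w x) * eint (I_sub c d \<nu> x) f"])
      (auto simp: weighted_primitive_def)
qed

lemma Ch_isometry:
  assumes p: "0 < p" and w: "w \<in> meas_fun c d"
    and fin: "AE x in lebesgue_on (einterval c d). \<bar>w x\<bar> \<noteq> \<infinity>"
  shows "f \<in> Ch c d \<nu> p w \<longleftrightarrow>
      f \<in> L1_loc c d \<nu> 1 \<and> weighted_primitive c d \<nu> w f \<in> Lp_fun (lebesgue_on (einterval c d)) p"
    and "f \<in> Ch c d \<nu> p w \<Longrightarrow>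
      Ch_norm c d \<nu> p w f = ereal (Lp_seminorm (lebesgue_on (einterval c d)) p (weighted_primitive c d \<nu> w f))"
proof -
  have "AE x in lebesgue_on (einterval c d). x \<in> einterval c d" by (rule AE_I2) simp
  with fin have eq: "AE x in lebesgue_on (einterval c d).
      \<bar>w x * ereal (eint (I_sub c d \<nu> x) f)\<bar> = ereal \<bar>weighted_primitive c d \<nu> w f x\<bar>"
  proof eventually_elim
    case (elim x)
    then show ?case by (cases "w x") (auto simp: weighted_primitive_def)
  qed
  show iff: "f \<in> Ch c d \<nu> p w \<longleftrightarrow>
      f \<in> L1_loc c d \<nu> 1 \<and> weighted_primitive c d \<nu> w f \<in> Lp_fun (lebesgue_on (einterval c d)) p"
    unfolding Ch_def Ch_norm_def
    using Lp_norm_real(1)[OF p borel_measurable_weighted_primitive[OF _ w] eq] by auto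
  assume "f \<in> Ch c d \<nu> p w"
  then show "Ch_norm c d \<nu> p w f =
      ereal (Lp_seminorm (lebesgue_on (einterval c d)) p (weighted_primitive c d \<nu> w f))"
    unfolding Ch_norm_def iff
    using Lp_norm_real(2)[OF p borel_measurable_weighted_primitive[OF _ w] eq] by auto
qed

section \<open>Functionals on the altered Cesaro-Copson space\<close>

lemma Ch_linear_space:
  assumes p: "1 \<le> p" and w: "w \<in> meas_fun c d"
    and fin: "AE x in lebesgue_on (einterval c d). \<bar>w x\<bar> \<noteq> \<infinity>"
  shows "(\<lambda>x. 0) \<in> Ch c d \<nu> p w"
    and "f \<in> Ch c d \<nu> p w \<Longrightarrow> g \<in> Ch c d \<nu> p w \<Longrightarrow> (\<lambda>x. f x + g x) \<in> Ch c d \<nu> p w"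
    and "f \<in> Ch c d \<nu> p w \<Longrightarrow> (\<lambda>x. ereal a * f x) \<in> Ch c d \<nu> p w"
proof -
  have p0: "0 < p" using p by simp
  note iff = Ch_isometry(1)[OF p0 w fin]
  note X = function_space_Lp_fun[OF p, of "lebesgue_on (einterval c d)"]
  have "(\<lambda>x. 0) \<in> L1_loc c d \<nu> 1"
    by (simp add: L1_loc_iff[unfolded One_nat_def] eintegrable_on_iff meas_fun_def)
  moreover have "weighted_primitive c d \<nu> w (\<lambda>x. 0) = (\<lambda>x. 0)"
    by (simp add: weighted_primitive_def eint_def fun_eq_iff)
  ultimately show "(\<lambda>x. 0) \<in> Ch c d \<nu> p w"
    unfolding iff using function_space_zero[OF X] by simp
  show "(\<lambda>x. f x + g x) \<in> Ch c d \<nu> p w" if "f \<in> Ch c d \<nu> p w" "g \<in> Ch c d \<nu> p w"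
  proof -
    note f = that(1)[unfolded iff] and g = that(2)[unfolded iff]
    show ?thesis
      unfolding iff weighted_primitive_add[OF conjunct1[OF f] conjunct1[OF g]]
      using f g L1_loc_add function_space_add[OF X] by blast
  qed
  show "(\<lambda>x. ereal a * f x) \<in> Ch c d \<nu> p w" if "f \<in> Ch c d \<nu> p w"
  proof -
    note f = that[unfolded iff]
    show ?thesis
      unfolding iff weighted_primitive_scale[OF conjunct1[OF f]]
      using f L1_loc_scale function_space_scale[OF X] by blast
  qed
qed

text \<open>
  Continuity at 0 gives a ball of radius \<open>\<delta>\<close> on which \<open>\<Lambda>\<close> is at most 1, so the operator norm is
  finite, and homogeneity gives the usual estimate. Scaling by \<open>N f + e\<close> instead of \<open>N f\<close> covers the
  functions of norm 0.
\<close>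

lemma Ch_dual_bounded:
  fixes \<Lambda> :: "(real \<Rightarrow> ereal) \<Rightarrow> real"
  assumes p1: "1 \<le> p" and w: "w \<in> meas_fun c d"
    and fin: "AE x in lebesgue_on (einterval c d). \<bar>w x\<bar> \<noteq> \<infinity>"
    and \<Lambda>: "\<Lambda> \<in> Ch_dual c d \<nu> p w"
  obtains C where "0 \<le> C" "Ch_dual_norm c d \<nu> p w \<Lambda> = ereal C"
    "\<And>f. f \<in> Ch c d \<nu> p w \<Longrightarrow>
      \<bar>\<Lambda> f\<bar> \<le> C * Lp_seminorm (lebesgue_on (einterval c d)) p (weighted_primitive c d \<nu> w f)"
proof -
  let ?Ch = "Ch c d \<nu> p w"
  have p: "0 < p" using p1 by simp
  note z = Ch_linear_space(1)[OF p1 w fin] and scaleCh = Ch_linear_space(3)[OF p1 w fin]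
  define N where "N f = Lp_seminorm (lebesgue_on (einterval c d)) p (weighted_primitive c d \<nu> w f)" for f
  have norm: "Ch_norm c d \<nu> p w f = ereal (N f)" if "f \<in> ?Ch" for f
    using Ch_isometry(2)[OF p w fin that] by (simp add: N_def)
  have scaleN: "N (\<lambda>x. ereal a * f x) = \<bar>a\<bar> * N f" if "f \<in> ?Ch" for a f
    using that unfolding N_def Ch_isometry(1)[OF p w fin]
    by (simp only: weighted_primitive_scale Lp_seminorm_scale[OF p])
  have scale\<Lambda>: "\<Lambda> (\<lambda>x. ereal a * f x) = a * \<Lambda> f" if "f \<in> ?Ch" for a f
    using \<Lambda> that unfolding Ch_dual_def by blast
  have \<Lambda>z: "\<Lambda> (\<lambda>x. 0) = 0" using scale\<Lambda>[OF z, of 0] by simp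
  obtain \<delta> where \<delta>: "0 < \<delta>"
    "\<And>g. g \<in> ?Ch \<Longrightarrow> Ch_norm c d \<nu> p w (\<lambda>x. g x - 0) < ereal \<delta> \<Longrightarrow> \<bar>\<Lambda> g - \<Lambda> (\<lambda>x. 0)\<bar> < 1"
  proof -
    have "\<forall>f\<in>?Ch. \<forall>\<epsilon>>0. \<exists>\<delta>>0. \<forall>g\<in>?Ch.
        Ch_norm c d \<nu> p w (\<lambda>x. g x - f x) < ereal \<delta> \<longrightarrow> \<bar>\<Lambda> g - \<Lambda> f\<bar> < \<epsilon>"
      using \<Lambda> unfolding Ch_dual_def by blast
    from this[rule_format, OF z zero_less_one] show thesis using that by blast
  qed
  have unit: "\<bar>\<Lambda> f\<bar> \<le> 2 / \<delta>" if f: "f \<in> ?Ch" "N f \<le> 1" for f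
  proof -
    let ?g = "\<lambda>x. ereal (\<delta> / 2) * f x"
    have "N ?g \<le> \<delta> / 2" using f(2) \<delta>(1) by (simp add: scaleN[OF f(1)])
    then have "\<bar>\<Lambda> ?g\<bar> < 1"
      using \<delta> norm[OF scaleCh[OF f(1), of "\<delta> / 2"]] scaleCh[OF f(1), of "\<delta> / 2"] \<Lambda>z by fastforce
    then have "\<bar>\<delta> / 2 * \<Lambda> f\<bar> < 1" by (simp only: scale\<Lambda>[OF f(1)])
    then show ?thesis using \<delta>(1) by (simp add: abs_mult field_simps)
  qed
  let ?D = "Ch_dual_norm c d \<nu> p w \<Lambda>"
  have upper: "ereal \<bar>\<Lambda> f\<bar> \<le> ?D" if "f \<in> ?Ch" "N f \<le> 1" for f
    unfolding Ch_dual_norm_def using that norm by (intro SUP_upper) auto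
  have "?D \<le> ereal (2 / \<delta>)"
    unfolding Ch_dual_norm_def using unit norm by (intro SUP_least) auto
  moreover have "0 \<le> ?D"
  proof -
    have "N (\<lambda>x. 0) = 0" using scaleN[OF z, of 0] by simp
    then show ?thesis by (intro order_trans[OF _ upper[OF z]]) simp_all
  qed
  ultimately obtain C where C: "?D = ereal C" "0 \<le> C" by (cases ?D) auto
  show thesis
  proof (rule that[OF C(2,1)], fold N_def)
    fix f assume f: "f \<in> ?Ch"
    have le: "\<bar>\<Lambda> f\<bar> \<le> C * (N f + e)" if e: "0 < e" for e
    proof -
      have b: "0 < N f + e" using e by (simp add: N_def add_nonneg_pos)
      have "N (\<lambda>x. ereal (1 / (N f + e)) * f x) \<le> 1"
        using b e by (simp add: scaleN[OF f])
      from upper[OF scaleCh[OF f] this] have "\<bar>1 / (N f + e) * \<Lambda> f\<bar> \<le> C"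
        by (simp only: scale\<Lambda>[OF f] C ereal_less_eq)
      then have "\<bar>\<Lambda> f\<bar> / (N f + e) \<le> C" using b by (simp add: abs_mult)
      then show ?thesis using b by (simp add: pos_divide_le_eq)
    qed
    have "((\<lambda>e. C * (N f + e)) \<longlongrightarrow> C * (N f + 0)) (at_right 0)"
      by (intro tendsto_intros)
    then have "\<bar>\<Lambda> f\<bar> \<le> C * (N f + 0)"
      by (rule tendsto_lowerbound) (auto simp: le intro!: eventually_at_rightI[of 0 1])
    then show "\<bar>\<Lambda> f\<bar> \<le> C * N f" by simp
  qed
qed

theorem theorem3p3:
  fixes c d :: ereal and p p' :: real and \<nu> :: nat
    and w :: "real \<Rightarrow> ereal" and \<Lambda> :: "(real \<Rightarrow> ereal) \<Rightarrow> real"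
  assumes "c < d"
    and "1 < p" and "p' = p / (p - 1)"
    and "\<nu> \<in> {1, 2}"
    and "w \<in> meas_fun c d"
    and "AE x in lebesgue_on (einterval c d). w x > 0"
    and "(\<lambda>x. epow (w x) p) \<in> L1_loc c d \<nu> 2"
    and "\<Lambda> \<in> Ch_dual c d \<nu> p w"
  shows "\<exists>h \<in> Lw c d p' (\<lambda>x. 1 / w x).
    (\<forall>f \<in> Ch c d \<nu> p w.
       eintegrable_on (\<lambda>x. h x * ereal (eint (I_sub c d \<nu> x) f)) (einterval c d) \<and>
       \<Lambda> f = eint (einterval c d) (\<lambda>x. h x * ereal (eint (I_sub c d \<nu> x) f))) \<and>
    Ch_dual_norm c d \<nu> p w \<Lambda> = Lw_norm c d p' (\<lambda>x. 1 / w x) h"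
proof -
  let ?I = "einterval c d" and ?Ch = "Ch c d \<nu> p w"
  let ?M = "lebesgue_on ?I"
  define T where "T = weighted_primitive c d \<nu> w"
  note w = \<open>w \<in> meas_fun c d\<close>
  have p: "0 < p" "1 \<le> p" "1 < p" and p': "1 < p'" "0 < p'" "1 / p + 1 / p' = 1"
    unfolding assms(3) using assms(2) by (auto simp: field_simps)
  interpret sigma_finite_measure ?M
    by (rule sigma_finite_lebesgue_on) (rule sets_einterval_lebesgue)
  have [measurable]: "w \<in> borel_measurable ?M" using w by (simp add: meas_fun_def)
  have w_AE: "AE x in ?M. 0 < w x \<and> w x \<noteq> \<infinity>"
    using assms(6) finite_AE_of_L1_loc_2[OF p(1) assms(7)] by eventually_elim simp
  have fin: "AE x in ?M. \<bar>w x\<bar> \<noteq> \<infinity>" using w_AE by eventually_elim auto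
  note Ch_iff = Ch_isometry(1)[OF p(1) w fin, of _ \<nu>, folded T_def]
  obtain C where C: "0 \<le> C" "Ch_dual_norm c d \<nu> p w \<Lambda> = ereal C"
    and bound: "\<And>f. f \<in> ?Ch \<Longrightarrow> \<bar>\<Lambda> f\<bar> \<le> C * Lp_seminorm ?M p (T f)"
    using Ch_dual_bounded[OF p(2) w fin assms(8)] unfolding T_def by blast
  note X = function_space_Lp_fun[OF p(2), of ?M]
  \<comment> \<open>The graph of the functional that \<open>\<Lambda>\<close> induces on the range of \<open>T\<close>.\<close>
  define R where "R = {(T f, \<Lambda> f) | f. f \<in> ?Ch}"
  have scaleR: "((\<lambda>x. a * v x), a * t) \<in> R" if vt: "(v, t) \<in> R" for a v t
  proof -
    obtain f where f: "f \<in> ?Ch" and v: "v = T f" "t = \<Lambda> f" using vt unfolding R_def by blast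
    have T: "T (\<lambda>x. ereal a * f x) = (\<lambda>x. a * v x)"
      using f unfolding Ch_iff v T_def by (intro weighted_primitive_scale) simp
    have "(\<lambda>x. ereal a * f x) \<in> ?Ch"
      using f by (rule Ch_linear_space(3)[OF p(2) w fin])
    moreover have "\<Lambda> (\<lambda>x. ereal a * f x) = a * t"
      using assms(8) f unfolding Ch_dual_def v by blast
    ultimately show ?thesis unfolding R_def T[symmetric] by auto
  qed
  have addR: "((\<lambda>x. v x + v' x), t + t') \<in> R" if vt: "(v, t) \<in> R" and vt': "(v', t') \<in> R" for v t v' t'
  proof -
    obtain f where f: "f \<in> ?Ch" and v: "v = T f" "t = \<Lambda> f" using vt unfolding R_def by blast
    obtain g where g: "g \<in> ?Ch" and v': "v' = T g" "t' = \<Lambda> g" using vt' unfolding R_def by blast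
    have T: "T (\<lambda>x. f x + g x) = (\<lambda>x. v x + v' x)"
      using f g unfolding Ch_iff v v' T_def by (intro weighted_primitive_add) simp_all
    have "(\<lambda>x. f x + g x) \<in> ?Ch"
      using f g by (rule Ch_linear_space(2)[OF p(2) w fin])
    moreover have "\<Lambda> (\<lambda>x. f x + g x) = t + t'"
      using assms(8) f g unfolding Ch_dual_def v v' by blast
    ultimately show ?thesis unfolding R_def T[symmetric] by auto
  qed
  have zero: "((\<lambda>x. 0), 0) \<in> R"
  proof -
    have "(T (\<lambda>x. 0), \<Lambda> (\<lambda>x. 0)) \<in> R"
      unfolding R_def using Ch_linear_space(1)[OF p(2) w fin] by blast
    from scaleR[OF this, of 0] show ?thesis by simp
  qed
  obtain \<Phi> where lin: "linear_functional_on (Lp_fun ?M p) \<Phi>"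
    and ext: "\<And>v t. (v, t) \<in> R \<Longrightarrow> \<Phi> v = t"
    and \<Phi>_le: "\<And>g. g \<in> Lp_fun ?M p \<Longrightarrow> \<Phi> g \<le> C * Lp_seminorm ?M p g"
  proof (rule Hahn_Banach_relation[OF X sublinear_on_Lp_seminorm[OF p(2) C(1)] zero])
    show "v \<in> Lp_fun ?M p" if "(v, t) \<in> R" for v t using that unfolding R_def Ch_iff by auto
    show "t \<le> C * Lp_seminorm ?M p v" if "(v, t) \<in> R" for v t
      using that bound unfolding R_def by force
  qed (use scaleR addR in auto)
  obtain u where u: "u \<in> Lp_fun ?M p'" "Lp_seminorm ?M p' u \<le> C"
    and rep: "\<And>g. g \<in> Lp_fun ?M p \<Longrightarrow> \<Phi> g = (LINT x|?M. g x * u x)"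
    using Riesz_representation_Lp[OF p(3) p'(3) lin \<Phi>_le C(1)] by blast
  note [measurable] = Lp_funD(1)[OF u(1)]
  define h where "h x = ereal (u x * real_of_ereal (w x))" for x
  have h_meas: "h \<in> meas_fun c d" unfolding h_def meas_fun_def by measurable
  have hw: "AE x in ?M. \<bar>h x * (1 / w x)\<bar> = ereal \<bar>u x\<bar>"
    using w_AE
  proof eventually_elim
    case (elim x)
    then obtain r where r: "w x = ereal r" "r \<noteq> 0" by (cases "w x") auto
    then have "h x * (1 / w x) = ereal (u x * r * inverse r)" by (simp add: h_def divide_ereal_def)
    with r show ?case by (simp add: mult.assoc)
  qed
  have "Lw_norm c d p' (\<lambda>x. 1 / w x) h < \<infinity>"
    unfolding Lw_norm_def
    using Lp_norm_real(1)[where u = "\<lambda>x. h x * (1 / w x)", OF p'(2) Lp_funD(1)[OF u(1)] hw] u(1) by (rule iffD2)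
  with h_meas have h_Lw: "h \<in> Lw c d p' (\<lambda>x. 1 / w x)" unfolding Lw_def by blast
  have h_norm: "Lw_norm c d p' (\<lambda>x. 1 / w x) h = ereal (Lp_seminorm ?M p' u)"
    unfolding Lw_norm_def
    by (rule Lp_norm_real(2)[where u = "\<lambda>x. h x * (1 / w x)", OF p'(2) Lp_funD(1)[OF u(1)] hw u(1)])
  have TX: "T f \<in> Lp_fun ?M p" if "f \<in> ?Ch" for f using that by (simp add: Ch_iff)
  have \<Lambda>_T: "\<Lambda> f = (LINT x|?M. T f x * u x)" if f: "f \<in> ?Ch" for f
  proof -
    have "(T f, \<Lambda> f) \<in> R" unfolding R_def using f by blast
    from ext[OF this] rep[OF TX[OF f]] show ?thesis by (rule trans[OF sym])
  qed
  have rep_h: "eintegrable_on (\<lambda>x. h x * ereal (eint (I_sub c d \<nu> x) f)) ?I \<and>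
      \<Lambda> f = eint ?I (\<lambda>x. h x * ereal (eint (I_sub c d \<nu> x) f))" if f: "f \<in> ?Ch" for f
  proof -
    have eq: "h x * ereal (eint (I_sub c d \<nu> x) f) = ereal (T f x * u x)" if "x \<in> space ?M" for x
      using that by (simp add: h_def T_def weighted_primitive_def)
    have int: "integrable ?M (\<lambda>x. T f x * u x)"
      by (rule Hoelder_inequality(1)[OF p(3) p'(1,3) TX[OF f] u(1)])
    have "(\<lambda>x. h x * ereal (eint (I_sub c d \<nu> x) f)) \<in> borel_measurable ?M"
    proof -
      have "(\<lambda>x. h x * ereal (eint (I_sub c d \<nu> x) f)) \<in> borel_measurable ?M \<longleftrightarrow>
          (\<lambda>x. ereal (T f x * u x)) \<in> borel_measurable ?M"
        by (rule measurable_cong) (rule eq)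
      with borel_measurable_ereal[OF borel_measurable_integrable[OF int]] show ?thesis by blast
    qed
    moreover have "AE x in ?M. \<bar>h x * ereal (eint (I_sub c d \<nu> x) f)\<bar> \<noteq> \<infinity>"
      by (rule AE_I2) (simp add: eq)
    moreover have "integrable ?M (\<lambda>x. real_of_ereal (h x * ereal (eint (I_sub c d \<nu> x) f)))"
    proof -
      have "integrable ?M (\<lambda>x. real_of_ereal (h x * ereal (eint (I_sub c d \<nu> x) f))) \<longleftrightarrow>
          integrable ?M (\<lambda>x. T f x * u x)"
        by (intro Bochner_Integration.integrable_cong refl) (simp only: eq real_of_ereal.simps)
      with int show ?thesis by blast
    qed
    moreover have "\<Lambda> f = eint ?I (\<lambda>x. h x * ereal (eint (I_sub c d \<nu> x) f))"
      unfolding \<Lambda>_T[OF f] eint_def[of ?I]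
      by (intro Bochner_Integration.integral_cong refl) (simp only: eq real_of_ereal.simps)
    ultimately show ?thesis unfolding eintegrable_on_iff by blast
  qed
  have "Ch_dual_norm c d \<nu> p w \<Lambda> \<le> ereal (Lp_seminorm ?M p' u)"
    unfolding Ch_dual_norm_def
  proof (rule SUP_least)
    fix f assume "f \<in> {f \<in> ?Ch. Ch_norm c d \<nu> p w f \<le> 1}"
    then have f: "f \<in> ?Ch" and "Ch_norm c d \<nu> p w f \<le> 1" by auto
    then have le1: "Lp_seminorm ?M p (T f) \<le> 1"
      unfolding Ch_isometry(2)[OF p(1) w fin f] T_def by simp
    have "\<bar>\<Lambda> f\<bar> \<le> (LINT x|?M. \<bar>T f x * u x\<bar>)"
      unfolding \<Lambda>_T[OF f] by (rule integral_abs_bound)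
    also have "\<dots> \<le> Lp_seminorm ?M p (T f) * Lp_seminorm ?M p' u"
      by (rule Hoelder_inequality(2)[OF p(3) p'(1,3) TX[OF f] u(1)])
    also have "\<dots> \<le> 1 * Lp_seminorm ?M p' u"
      by (rule mult_right_mono[OF le1 Lp_seminorm_nonneg])
    finally show "ereal \<bar>\<Lambda> f\<bar> \<le> ereal (Lp_seminorm ?M p' u)" by simp
  qed
  then have "Ch_dual_norm c d \<nu> p w \<Lambda> = Lw_norm c d p' (\<lambda>x. 1 / w x) h"
    unfolding h_norm C(2) using u(2) by (simp only: ereal_less_eq ereal.inject antisym)
  moreover have "\<forall>f\<in>?Ch. eintegrable_on (\<lambda>x. h x * ereal (eint (I_sub c d \<nu> x) f)) ?I \<and>
      \<Lambda> f = eint ?I (\<lambda>x. h x * ereal (eint (I_sub c d \<nu> x) f))"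
    using rep_h by (rule ballI)
  ultimately show ?thesis by (intro bexI[OF _ h_Lw] conjI)
qed

end
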